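(* Let $3\le n\le d$. There are (sufficiently small) fixed neighbourhoods $N_1,\dots,N_n$ of the standard basis vectors $e_1,\dots,e_n$ in $\mathbf S^{d-1}\subset\mathbb R^d$, depending only on $n$ and $d$, such that the following holds. If $\frac{n}{n-1}<q\le\infty$ then there exists a constant $C<\infty$ such that for all $0<\delta\le1$ and all finite families $\mathbb T_1,\dots,\mathbb T_n$ of $\delta$-tubes in $\mathbb R^d$ for which, for each $1\le j\le n$, every tube in $\mathbb T_j$ has its long side pointing in a direction belonging to $N_j$, $$\Bigl\|\prod_{j=1}^{n}\Bigl(\sum_{T_j\in\mathbb T_j}\chi_{T_j}\Bigr)\Bigr\|_{L^{q/n}(\mathbb R^d)}\le C\prod_{j=1}^{n}\bigl(\delta^{d/q}\,\#\mathbb T_j\bigr).$$ Here $C$ is independent of $\delta$ and of the families of tubes.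
   Context: A $\delta$-tube in $\mathbb R^d$ is a rectangular box (of arbitrary position and orientation) with $d-1$ sides of length $\delta$ and one side of length $1$ (the long side). $\chi_T$ denotes the indicator function of $T$ and $\#\mathbb T$ the cardinality of $\mathbb T$. Tubes within a single family may be parallel. For $0<r<1$, $\|F\|_{L^r}=(\int|F|^r)^{1/r}$; for $q=\infty$ one reads $q/n=\infty$ and $\delta^{d/q}=1$. *)

theory Defs
  imports "HOL-Analysis.Analysis" "HOL-Probability.Essential_Supremum"
begin

(* The L^r (quasi-)norm for 0 < r <= \<infinity>, with values in [0, \<infinity>]. Nothing is
   claimed for r <= 0. *)
definition Lnorm :: "'a measure \<Rightarrow> ereal \<Rightarrow> ('a \<Rightarrow> real) \<Rightarrow> ennreal" where
  "Lnorm M r F =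
     (if r = \<infinity> then esssup M (\<lambda>x. ennreal \<bar>F x\<bar>)
      else let p = real_of_ereal r;
               I = (\<integral>\<^sup>+ x. ennreal (\<bar>F x\<bar> powr p) \<partial>M)
           in if I = \<infinity> then \<infinity> else ennreal (enn2real I powr (1 / p)))"

definition orthonormal_frame :: "('d::finite \<Rightarrow> real ^ 'd) \<Rightarrow> bool" where
  "orthonormal_frame u \<longleftrightarrow> (\<forall>i j. u i \<bullet> u j = (if i = j then 1 else 0))"

(* Centre c, sides parallel to the vectors u i, of length l i. *)
definition rectangular_box ::
  "real ^ 'd \<Rightarrow> ('d::finite \<Rightarrow> real ^ 'd) \<Rightarrow> ('d \<Rightarrow> real) \<Rightarrow> (real ^ 'd) set" where
  "rectangular_box c u l = {x. \<forall>i. \<bar>(x - c) \<bullet> u i\<bar> \<le> l i / 2}"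

(* T is a \<delta>-tube and the unit vector \<omega> is a direction of its long side. The
   direction is only determined up to sign; for \<delta> = 1 every side is a long side. *)
definition tube_with_direction ::
  "real \<Rightarrow> real ^ 'd::finite \<Rightarrow> (real ^ 'd) set \<Rightarrow> bool" where
  "tube_with_direction \<delta> \<omega> T \<longleftrightarrow>
     (\<exists>c u k. orthonormal_frame u \<and> u k = \<omega> \<and>
        T = rectangular_box c u (\<lambda>i. if i = k then 1 else \<delta>))"

end

theory Submission
  imports Defs
begin

text \<open>
  Put \<open>p = q / n\<close>, so that \<open>p > 1 / (n - 1)\<close>. For finite \<open>q\<close> the claim is that the integral of the
  \<open>p\<close>-th power of the product is at most a constant times \<open>\<delta>\<^sup>d\<close> times the \<open>p\<close>-th power of the product
  of the cardinalities; for \<open>q = \<infinity>\<close> it is the trivial pointwise bound.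

  All the analysis is removed at once. In suitable linear coordinates space is cut into cells of side
  \<open>\<delta>\<close>, and a tube becomes the set of lattice points that index the cells it meets. The only property
  of these sets that matters is \<open>thin\<close>: along a set of direction \<open>j\<close>, every other coordinate varies by
  at most \<open>\<theta>\<close> times the variation of the \<open>j\<close>-th coordinate, up to an additive constant. It remains to
  prove a counting inequality (\<open>discrete_multilinear_kakeya\<close>) for a \<open>\<theta>\<close> that may depend on \<open>p\<close>. Since
  \<open>\<theta>\<close> must be small, each neighbourhood \<open>N j\<close>, whose size depends on \<open>d\<close> alone, is covered by finitely
  many caps of radius comparable to \<open>\<theta>\<close>. For each choice of one cap per family a linear change of
  variables moves the centres of the caps to basis vectors (\<open>near_standard_basis_coordinates\<close>), and the
  estimates for all choices are added (\<open>multilinear_kakeya_powr\<close>).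

  The counting inequality is proved by induction on the number of tubes. Fix a small \<open>s > 0\<close>, and let
  \<open>Q\<close> be a smallest cube that is met by a proportion at least \<open>1 - s\<close> of the tubes in every family.
  Two effects compete.

  \<^item> Outside a fixed dilate of \<open>Q\<close>, a point lies on tubes through \<open>Q\<close> of at most one family, because
    tubes of different families separate once they have met. In the other \<open>n - 1\<close> families only the
    tubes that miss \<open>Q\<close> count, which form a proportion at most \<open>s\<close>. By induction such points contribute
    at most \<open>n s\<^bsup>(n - 1) p\<^esup>\<close> times the desired bound, and the exponent \<open>(n - 1) p\<close> exceeds \<open>1\<close>.

  \<^item> Inside the dilate, cut it into cubes slightly smaller than \<open>Q\<close>. By minimality every such cube
    is missed by a proportion more than \<open>s\<close> of the tubes of some family. Apply induction to each
    cube, and sum the results by the Loomis--Whitney inequality, whose exponent is \<open>1 / (n - 1)\<close>; the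
    remaining exponent \<open>h = p - 1 / (n - 1)\<close> yields a gain \<open>(1 - s)\<^bsup>h\<^esup>\<close>, which is about \<open>1 - h s\<close>.
    The loss here is only a factor \<open>1 + \<tau>\<close> with \<open>\<tau>\<close> as small as desired: when \<open>\<theta>\<close> is small, a tube
    runs in a single column of cubes unless it crosses a wall, and a good translate of the
    grid has few tubes crossing walls (\<open>single_scale_kakeya\<close>).

  For small \<open>s\<close> the gain, which is linear in \<open>s\<close>, beats the superlinear loss, so the induction closes
  with a constant independent of all scales. Both effects use that \<open>p > 1 / (n - 1)\<close> strictly.
\<close>

section \<open>The discrete Loomis--Whitney inequality\<close>

text \<open>Normalise both sums to be \<open>1\<close> and apply the weighted inequality between the arithmetic and the
  geometric mean to each term.\<close>
lemma Hoelder_two: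
  fixes f g :: "'a \<Rightarrow> real"
  assumes "finite A" "\<And>x. x \<in> A \<Longrightarrow> 0 \<le> f x" "\<And>x. x \<in> A \<Longrightarrow> 0 \<le> g x"
    and "0 \<le> a" "0 \<le> b" "a + b = 1"
  shows "(\<Sum>x\<in>A. f x powr a * g x powr b) \<le> (\<Sum>x\<in>A. f x) powr a * (\<Sum>x\<in>A. g x) powr b"
proof -
  define F where "F = sum f A"
  define G where "G = sum g A"
  have F0: "F \<ge> 0" and G0: "G \<ge> 0" unfolding F_def G_def using assms by (auto intro!: sum_nonneg)
  show ?thesis
  proof (cases "F = 0 \<or> G = 0")
    case True
    then have "(\<forall>x\<in>A. f x = 0) \<or> (\<forall>x\<in>A. g x = 0)"
      unfolding F_def G_def using assms sum_nonneg_eq_0_iff by metis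
    then have "(\<Sum>x\<in>A. f x powr a * g x powr b) = 0"
      by (intro sum.neutral) auto
    then show ?thesis by simp
  next
    case False
    have pt: "f x powr a * g x powr b \<le> F powr a * G powr b * (a * (f x / F) + b * (g x / G))"
      if "x \<in> A" for x
    proof (cases "f x = 0 \<or> g x = 0")
      case True
      then show ?thesis using that assms F0 G0 by auto
    next
      case nz: False
      have "f x powr a * g x powr b
        = F powr a * G powr b * ((f x / F) powr a * (g x / G) powr b)"
        using that assms F0 G0 False by (simp add: powr_divide)
      also have "\<dots> \<le> F powr a * G powr b * (a * (f x / F) + b * (g x / G))"
        using that assms F0 G0 False nz
        by (intro mult_left_mono Youngs_inequality_0 divide_pos_pos) (auto simp: less_le)
      finally show ?thesis .
    qed
    have "(\<Sum>x\<in>A. f x powr a * g x powr b)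
       \<le> (\<Sum>x\<in>A. F powr a * G powr b * (a * (f x / F) + b * (g x / G)))"
      by (intro sum_mono pt)
    also have "\<dots> = F powr a * G powr b * (a * (sum f A / F) + b * (sum g A / G))"
      by (simp add: sum_distrib_left sum.distrib sum_divide_distrib distrib_left)
    also have "\<dots> = F powr a * G powr b"
      using False assms unfolding F_def[symmetric] G_def[symmetric] by simp
    finally show ?thesis by (simp add: F_def G_def)
  qed
qed

lemma Hoelder_prod:
  fixes g :: "'j \<Rightarrow> 'a \<Rightarrow> real"
  assumes "finite A" "finite J" "J \<noteq> {}" "\<And>j x. j \<in> J \<Longrightarrow> x \<in> A \<Longrightarrow> 0 \<le> g j x"
  shows "(\<Sum>x\<in>A. \<Prod>j\<in>J. g j x powr (1 / real (card J)))
      \<le> (\<Prod>j\<in>J. (\<Sum>x\<in>A. g j x) powr (1 / real (card J)))"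
proof -
  define G where "G j = sum (g j) A" for j
  define m where "m = real (card J)"
  have m0: "m > 0" using assms unfolding m_def by (simp add: card_gt_0_iff)
  have G0: "G j \<ge> 0" if "j \<in> J" for j using assms that by (auto simp: G_def intro!: sum_nonneg)
  show ?thesis
  proof (cases "\<exists>j\<in>J. G j = 0")
    case True
    then obtain j where j: "j \<in> J" "G j = 0" by blast
    then have "\<forall>x\<in>A. g j x = 0"
      unfolding G_def using assms sum_nonneg_eq_0_iff[of A "g j"] by blast
    then have "(\<Sum>x\<in>A. \<Prod>j\<in>J. g j x powr (1 / m)) = 0"
      using j assms by (intro sum.neutral ballI prod_zero) auto
    then show ?thesis unfolding m_def by (simp add: prod_nonneg)
  next
    case False
    have Gp: "G j > 0" if "j \<in> J" for j using False G0[OF that] that by force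
    have pt: "(\<Prod>j\<in>J. g j x powr (1/m))
        \<le> (\<Prod>j\<in>J. G j powr (1/m)) * (\<Sum>j\<in>J. (g j x / G j) / m)" if x: "x \<in> A" for x
    proof -
      have "(\<Prod>j\<in>J. g j x powr (1/m))
         = (\<Prod>j\<in>J. G j powr (1/m)) * (\<Prod>j\<in>J. (g j x / G j) powr (1/m))"
        unfolding prod.distrib[symmetric]
        using assms x Gp by (intro prod.cong) (auto simp: powr_divide less_imp_le less_imp_neq[THEN not_sym])
      also have "(\<Prod>j\<in>J. (g j x / G j) powr (1/m)) = (\<Prod>j\<in>J. g j x / G j) powr (1/m)"
        using assms x Gp by (subst prod_powr_distrib) (auto simp: less_imp_le)
      also have "\<dots> \<le> (\<Sum>j\<in>J. (g j x / G j) / m)"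
        unfolding m_def using assms x Gp by (intro arith_geom_mean) (auto simp: less_imp_le)
      finally show ?thesis by (simp add: mult_left_mono prod_nonneg)
    qed
    have "(\<Sum>x\<in>A. \<Prod>j\<in>J. g j x powr (1/m))
        \<le> (\<Sum>x\<in>A. (\<Prod>j\<in>J. G j powr (1/m)) * (\<Sum>j\<in>J. (g j x / G j) / m))"
      by (intro sum_mono pt)
    also have "\<dots> = (\<Prod>j\<in>J. G j powr (1/m)) * (\<Sum>j\<in>J. (\<Sum>x\<in>A. g j x) / G j / m)"
      by (subst sum.swap[of _ A J, symmetric] | simp add: sum_distrib_left[symmetric] sum_divide_distrib)+
    also have "(\<Sum>j\<in>J. (\<Sum>x\<in>A. g j x) / G j / m) = (\<Sum>j\<in>J. 1 / m)"
      using Gp by (intro sum.cong) (auto simp: G_def less_imp_neq[THEN not_sym])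
    also have "\<dots> = 1" using m0 by (simp add: m_def)
    finally show ?thesis by (simp add: m_def G_def)
  qed
qed

lemma sum_PiE_remove:
  fixes h :: "('i \<Rightarrow> 'a) \<Rightarrow> 'b::comm_monoid_add"
  assumes "k \<in> D"
  shows "(\<Sum>x\<in>PiE D (\<lambda>_. A). h x) = (\<Sum>a\<in>A. \<Sum>y\<in>PiE (D - {k}) (\<lambda>_. A). h (y(k := a)))"
proof -
  have "PiE D (\<lambda>_. A) = (\<lambda>(a, y). y(k := a)) ` (A \<times> PiE (D - {k}) (\<lambda>_. A))"
    using PiE_insert_eq[of k "D - {k}" "\<lambda>_. A"] assms by (simp add: insert_absorb)
  moreover have "inj_on (\<lambda>(a, y). y(k := a)) (A \<times> PiE (D - {k}) (\<lambda>_. A))"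
    by (intro inj_combinator) simp
  ultimately have "(\<Sum>x\<in>PiE D (\<lambda>_. A). h x)
      = (\<Sum>(a,y)\<in>A \<times> PiE (D - {k}) (\<lambda>_. A). h (y(k := a)))"
    by (simp add: sum.reindex case_prod_unfold o_def)
  then show ?thesis by (simp add: sum.cartesian_product)
qed

text \<open>Functions independent of the \<open>j\<close>-th coordinate are modelled as functions on the points whose
  \<open>j\<close>-th coordinate is \<open>undefined\<close>. The coordinates in \<open>D - J\<close> are arbitrary spectators, which is what
  handles fewer families than dimensions. That the constant is \<open>1\<close> is essential below, where
  the inequality is used anew in each step of an induction.

  The proof removes one \<open>k \<in> J\<close>. For a fixed \<open>k\<close>-th coordinate, Hoelder's inequality splits off the
  factor of index \<open>k\<close>, which does not see that coordinate, and the induction hypothesis bounds the rest;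
  then Hoelder's inequality for \<open>card J - 1\<close> functions sums over the \<open>k\<close>-th coordinate.\<close>
lemma discrete_Loomis_Whitney:
  fixes f :: "'i \<Rightarrow> ('i \<Rightarrow> 'a) \<Rightarrow> real"
  assumes "finite D" "J \<subseteq> D" "2 \<le> card J" "finite A" "\<And>j x. j \<in> J \<Longrightarrow> 0 \<le> f j x"
  shows "(\<Sum>x\<in>PiE D (\<lambda>_. A). \<Prod>j\<in>J. f j (x(j := undefined)) powr (1 / (real (card J) - 1)))
      \<le> (\<Prod>j\<in>J. (\<Sum>x\<in>PiE (D - {j}) (\<lambda>_. A). f j x) powr (1 / (real (card J) - 1)))"
proof -
  obtain m where "card J = m + 2" using assms(3) by (metis add.commute le_Suc_ex)
  then show ?thesis using assms(1,2,5)
  proof (induction m arbitrary: D J f)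
    case 0
    then obtain j k where J: "J = {j, k}" "j \<noteq> k" by (auto simp: card_2_iff numeral_2_eq_2[symmetric])
    have jk: "j \<in> D" "k \<in> D" "k \<in> D - {j}" using J 0 by auto
    have fin: "finite (PiE B (\<lambda>_. A))" if "B \<subseteq> D" for B
      using that \<open>finite D\<close> \<open>finite A\<close> by (intro finite_PiE) (auto intro: finite_subset)
    have nn: "0 \<le> f j x" "0 \<le> f k x" for x using 0 J by auto
    have "(\<Sum>x\<in>PiE D (\<lambda>_. A). f j (x(j := undefined)) * f k (x(k := undefined)))
       = (\<Sum>a\<in>A. \<Sum>y\<in>PiE (D - {k}) (\<lambda>_. A). f j ((y(j := undefined))(k := a)) * f k y)"
      unfolding sum_PiE_remove[OF jk(2)]
      using J by (intro sum.cong refl) (auto simp: fun_upd_twist PiE_def extensional_def fun_upd_idem)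
    also have "\<dots> = (\<Sum>y\<in>PiE (D - {k}) (\<lambda>_. A). f k y * (\<Sum>a\<in>A. f j ((y(j := undefined))(k := a))))"
      by (subst sum.swap) (simp add: sum_distrib_left mult.commute)
    also have "\<dots> \<le> (\<Sum>y\<in>PiE (D - {k}) (\<lambda>_. A). f k y * (\<Sum>z\<in>PiE (D - {j}) (\<lambda>_. A). f j z))"
    proof (intro sum_mono mult_left_mono nn)
      fix y assume y: "y \<in> PiE (D - {k}) (\<lambda>_. A)"
      have "y(j := undefined) \<in> PiE (D - {j} - {k}) (\<lambda>_. A)"
        using y by (auto simp: PiE_def extensional_def)
      then show "(\<Sum>a\<in>A. f j ((y(j := undefined))(k := a))) \<le> (\<Sum>z\<in>PiE (D - {j}) (\<lambda>_. A). f j z)"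
        unfolding sum_PiE_remove[OF jk(3)]
        by (intro sum_mono member_le_sum[where f = "\<lambda>w. f j (w(k := _))"]) (auto intro: nn fin)
    qed
    also have "\<dots> = (\<Sum>x\<in>PiE (D - {j}) (\<lambda>_. A). f j x) * (\<Sum>x\<in>PiE (D - {k}) (\<lambda>_. A). f k x)"
      by (simp add: sum_distrib_right[symmetric])
    finally have ineq: "(\<Sum>x\<in>PiE D (\<lambda>_. A). f j (x(j := undefined)) * f k (x(k := undefined)))
      \<le> (\<Sum>x\<in>PiE (D - {j}) (\<lambda>_. A). f j x) * (\<Sum>x\<in>PiE (D - {k}) (\<lambda>_. A). f k x)" .
    have cJ: "1 / (real (card J) - 1) = 1" using J by simp
    show ?case
      unfolding cJ using ineq J nn by (simp add: sum_nonneg del: fun_upd_apply cong: sum.cong_simp)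
  next
    case (Suc m)
    then have "J \<noteq> {}" by auto
    then obtain k where k: "k \<in> J" by blast
    have kD: "k \<in> D" using k Suc by auto
    have finJ: "finite J" using Suc by (meson finite_subset)
    define J' where "J' = J - {k}"
    have cJ': "card J' = m + 2" using Suc k finJ by (simp add: J'_def)
    have J'ne: "J' \<noteq> {}" "finite J'" using cJ' by (auto intro!: card_ge_0_finite)
    have Jins: "J = insert k J'" "k \<notin> J'" using k by (auto simp: J'_def)
    define e where "e = 1 / (real (card J) - 1)"
    define e' where "e' = 1 / (real (card J') - 1)"
    have ee: "e = 1 / real (card J')" "0 \<le> e" "e \<le> 1" "e' * (1 - e) = e"
      using Suc.prems(1) cJ' by (auto simp: e_def e'_def field_simps)
    define f' where "f' a j z = f j (z(k := a))" for a j z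
    have nn: "0 \<le> f j x" if "j \<in> J" for j x using Suc.prems(4) that .
    have nn': "0 \<le> f' a j x" if "j \<in> J'" for a j x using that by (auto simp: f'_def J'_def intro: nn)
    define P where "P = PiE (D - {k}) (\<lambda>_. A)"
    have finP: "finite P" unfolding P_def using Suc \<open>finite A\<close> by (intro finite_PiE) auto
    define S where "S a j = (\<Sum>z\<in>PiE (D - {k} - {j}) (\<lambda>_. A). f' a j z)" for a j
    have S0: "0 \<le> S a j" if "j \<in> J'" for a j using that by (auto simp: S_def intro!: sum_nonneg nn')
    have LHS: "(\<Sum>x\<in>PiE D (\<lambda>_. A). \<Prod>j\<in>J. f j (x(j := undefined)) powr e)
       = (\<Sum>a\<in>A. \<Sum>y\<in>P. f k y powr e * (\<Prod>j\<in>J'. f' a j (y(j := undefined)) powr e' ) powr (1 - e))"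
      unfolding sum_PiE_remove[OF kD] P_def[symmetric]
    proof (intro sum.cong refl)
      fix a y assume y: "y \<in> P"
      have 1: "(y(k := a))(k := undefined) = y"
        using y by (auto simp: P_def PiE_def extensional_def)
      have "(\<Prod>j\<in>J'. f j ((y(k := a))(j := undefined)) powr e)
          = (\<Prod>j\<in>J'. (f' a j (y(j := undefined)) powr e') powr (1 - e))"
        using Jins(2)
        by (intro prod.cong refl) (metis (no_types, lifting) ee(4) f'_def fun_upd_twist powr_powr)
      also have "\<dots> = (\<Prod>j\<in>J'. f' a j (y(j := undefined)) powr e') powr (1 - e)"
        by (rule prod_powr_distrib[symmetric])
      finally show "(\<Prod>j\<in>J. f j ((y(k := a))(j := undefined)) powr e)
        = f k y powr e * (\<Prod>j\<in>J'. f' a j (y(j := undefined)) powr e' ) powr (1 - e)"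
        using Jins J'ne 1 by simp
    qed
    have inner: "(\<Sum>y\<in>P. f k y powr e * (\<Prod>j\<in>J'. f' a j (y(j := undefined)) powr e' ) powr (1 - e))
        \<le> sum (f k) P powr e * (\<Prod>j\<in>J'. S a j powr e)" for a
    proof -
      have "(\<Sum>y\<in>P. f k y powr e * (\<Prod>j\<in>J'. f' a j (y(j := undefined)) powr e' ) powr (1 - e))
         \<le> sum (f k) P powr e * (\<Sum>y\<in>P. \<Prod>j\<in>J'. f' a j (y(j := undefined)) powr e' ) powr (1 - e)"
        using ee k by (intro Hoelder_two finP prod_nonneg) (auto intro: nn)
      also have "\<dots> \<le> sum (f k) P powr e * (\<Prod>j\<in>J'. S a j powr e') powr (1 - e)"
        unfolding P_def S_def e'_def using ee Suc.prems
        by (intro mult_left_mono powr_mono2 Suc.IH cJ') (auto simp: J'_def intro!: sum_nonneg prod_nonneg nn')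
      also have "(\<Prod>j\<in>J'. S a j powr e') powr (1 - e) = (\<Prod>j\<in>J'. S a j powr e)"
        by (subst prod_powr_distrib) (auto simp: powr_powr ee(4))
      finally show ?thesis .
    qed
    have "(\<Sum>x\<in>PiE D (\<lambda>_. A). \<Prod>j\<in>J. f j (x(j := undefined)) powr e)
       \<le> (\<Sum>a\<in>A. sum (f k) P powr e * (\<Prod>j\<in>J'. S a j powr e))"
      unfolding LHS by (intro sum_mono inner)
    also have "\<dots> = sum (f k) P powr e * (\<Sum>a\<in>A. \<Prod>j\<in>J'. S a j powr e)"
      by (simp add: sum_distrib_left)
    also have "\<dots> \<le> sum (f k) P powr e * (\<Prod>j\<in>J'. (\<Sum>a\<in>A. S a j) powr e)"
      using Hoelder_prod[OF \<open>finite A\<close> J'ne(2,1), of "\<lambda>j a. S a j"] S0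
      by (intro mult_left_mono) (auto simp: ee(1))
    also have "(\<Prod>j\<in>J'. (\<Sum>a\<in>A. S a j) powr e)
        = (\<Prod>j\<in>J'. (\<Sum>x\<in>PiE (D - {j}) (\<lambda>_. A). f j x) powr e)"
    proof (intro prod.cong refl)
      fix j assume j: "j \<in> J'"
      have kj: "k \<in> D - {j}" using j Jins kD by auto
      have "D - {k} - {j} = D - {j} - {k}" by auto
      then show "(\<Sum>a\<in>A. S a j) powr e = (\<Sum>x\<in>PiE (D - {j}) (\<lambda>_. A). f j x) powr e"
        unfolding sum_PiE_remove[OF kj] S_def f'_def by simp
    qed
    finally show ?case
      unfolding e_def[symmetric] using Jins J'ne by (simp add: P_def)
  qed
qed

section \<open>Thin sets and a single scale\<close>

text \<open>A combinatorial tube of direction \<open>j\<close>: a set of lattice points that, seen from any of its points,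
  lies in a cone of aperture \<open>\<theta>\<close> about the \<open>j\<close>-th axis, thickened by \<open>w\<close>.\<close>
definition thin :: "real \<Rightarrow> real \<Rightarrow> 'i \<Rightarrow> ('i \<Rightarrow> int) set \<Rightarrow> bool" where
  "thin \<theta> w j S \<longleftrightarrow>
     (\<forall>x\<in>S. \<forall>y\<in>S. \<forall>i. i \<noteq> j \<longrightarrow> \<bar>real_of_int (x i - y i)\<bar> \<le> \<theta> * \<bar>real_of_int (x j - y j)\<bar> + w)"

lemma thin_mono: "thin \<theta> w j S \<Longrightarrow> \<theta> \<le> \<theta>' \<Longrightarrow> thin \<theta>' w j S"
  unfolding thin_def by (blast intro: order_trans add_right_mono mult_right_mono abs_ge_zero)

definition hits :: "('t \<Rightarrow> 'a set) \<Rightarrow> 't set \<Rightarrow> 'a set \<Rightarrow> 't set" where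
  "hits S I A = {T \<in> I. S T \<inter> A \<noteq> {}}"

text \<open>The index of the cube that contains \<open>x\<close> in the grid of cubes of side \<open>m\<close> translated by \<open>\<alpha>\<close>.\<close>
definition block :: "int \<Rightarrow> ('i \<Rightarrow> int) \<Rightarrow> ('i \<Rightarrow> int) \<Rightarrow> ('i \<Rightarrow> int)" where
  "block m \<alpha> x = (\<lambda>i. (x i - \<alpha> i) div m)"

text \<open>A translate \<open>a\<close> of the grid separates two points of \<open>V\<close> only if some wall, that is an integer
  congruent to \<open>a\<close> modulo \<open>m\<close>, lies between the extreme points of \<open>V\<close>; these are at most \<open>l\<close> apart.\<close>
lemma card_crossing_shifts:
  fixes V :: "int set" and l :: real
  assumes "finite V" and range: "\<And>u v. u \<in> V \<Longrightarrow> v \<in> V \<Longrightarrow> real_of_int (v - u) \<le> l"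
    and "0 \<le> l" "0 < m"
  shows "real (card {a\<in>{0..<m}. \<exists>u\<in>V. \<exists>v\<in>V. (u - a) div m \<noteq> (v - a) div m}) \<le> l"
proof (cases "V = {}")
  case True
  then show ?thesis using assms by simp
next
  case False
  define u0 where "u0 = Min V"
  define v0 where "v0 = Max V"
  have "{a\<in>{0..<m}. \<exists>u\<in>V. \<exists>v\<in>V. (u - a) div m \<noteq> (v - a) div m} \<subseteq> (\<lambda>z. z mod m) ` {u0 + 1..v0}"
  proof clarify
    fix a u v assume a: "a \<in> {0..<m}" and uv: "u \<in> V" "v \<in> V" "(u - a) div m \<noteq> (v - a) div m"
    then obtain u v where uv: "u \<in> V" "v \<in> V" "(u - a) div m < (v - a) div m"
      by (metis linorder_neqE)
    define z where "z = m * ((v - a) div m) + a"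
    have "z mod m = a" using a by (simp add: z_def)
    moreover have "z \<le> v"
      using mult_div_mod_eq[of m "v - a"] pos_mod_sign[OF \<open>0 < m\<close>, of "v - a"]
      unfolding z_def by linarith
    moreover have "u < z"
    proof -
      have "m * ((u - a) div m) + m \<le> m * ((v - a) div m)"
        using uv(3) \<open>0 < m\<close> by (metis add.commute add1_zle_eq distrib_left mult.right_neutral mult_le_cancel_left_pos)
      moreover have "u - a < m * ((u - a) div m) + m"
        using mult_div_mod_eq[of m "u - a"] pos_mod_bound[OF \<open>0 < m\<close>, of "u - a"] by linarith
      ultimately show ?thesis unfolding z_def by linarith
    qed
    moreover have "u0 \<le> u" "v \<le> v0" using uv assms by (auto simp: u0_def v0_def)
    ultimately show "a \<in> (\<lambda>z. z mod m) ` {u0 + 1..v0}" by (intro image_eqI[of _ _ z]) auto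
  qed
  then have "card {a\<in>{0..<m}. \<exists>u\<in>V. \<exists>v\<in>V. (u - a) div m \<noteq> (v - a) div m} \<le> card {u0 + 1..v0}"
    by (meson card_image_le card_mono finite_atLeastAtMost_int finite_imageI le_trans)
  also have "\<dots> = nat (v0 - u0)" by simp
  finally have "real (card {a\<in>{0..<m}. \<exists>u\<in>V. \<exists>v\<in>V. (u - a) div m \<noteq> (v - a) div m}) \<le> real (nat (v0 - u0))"
    by linarith
  moreover have "u0 \<in> V" "v0 \<in> V" "u0 \<le> v0" using False assms by (auto simp: u0_def v0_def)
  ultimately show ?thesis using range[of u0 v0] by simp
qed

lemma sum_card_swap:
  assumes "finite A" "finite B"
  shows "(\<Sum>a\<in>A. real (card {b\<in>B. R a b})) = (\<Sum>b\<in>B. real (card {a\<in>A. R a b}))"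
proof -
  have "(\<Sum>a\<in>A. real (card {b\<in>B. R a b})) = (\<Sum>a\<in>A. \<Sum>b\<in>B. if R a b then 1 else 0)"
    using assms by (simp add: sum.If_cases Int_def)
  also have "\<dots> = (\<Sum>b\<in>B. \<Sum>a\<in>A. if R a b then 1 else 0)"
    by (rule sum.swap)
  also have "\<dots> = (\<Sum>b\<in>B. real (card {a\<in>A. R a b}))"
    using assms by (simp add: sum.If_cases Int_def)
  finally show ?thesis .
qed

text \<open>On average over the \<open>m\<close> translates, a proportion at most \<open>l / m\<close> of each family crosses a wall.
  Averaging the sum of the proportions over all families gives one translate that is good for all of
  them, at the cost of the factor \<open>card J\<close>.\<close>
lemma good_shift_exists:
  fixes I :: "'j \<Rightarrow> 't set" and W :: "'t \<Rightarrow> int set" and l :: real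
  assumes "finite J" "\<And>j. j \<in> J \<Longrightarrow> finite (I j)" "\<And>j. j \<in> J \<Longrightarrow> I j \<noteq> {}"
    and "\<And>j T. j \<in> J \<Longrightarrow> T \<in> I j \<Longrightarrow> finite (W T)"
    and range: "\<And>j T u v. j \<in> J \<Longrightarrow> T \<in> I j \<Longrightarrow> u \<in> W T \<Longrightarrow> v \<in> W T \<Longrightarrow> real_of_int (v - u) \<le> l"
    and "0 \<le> l" "0 < m"
  shows "\<exists>a. \<forall>j\<in>J. real (card {T\<in>I j. \<exists>u\<in>W T. \<exists>v\<in>W T. (u - a) div m \<noteq> (v - a) div m})
      \<le> real (card J) * l / real_of_int m * real (card (I j))"
proof -
  define bad where "bad j a = {T\<in>I j. \<exists>u\<in>W T. \<exists>v\<in>W T. (u - a) div m \<noteq> (v - a) div m}" for j a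
  define g where "g a = (\<Sum>j\<in>J. real (card (bad j a)) / real (card (I j)))" for a
  have Ipos: "real (card (I j)) > 0" if "j \<in> J" for j
    using assms that by (simp add: card_gt_0_iff)
  have swap: "(\<Sum>a\<in>{0..<m}. real (card (bad j a))) \<le> l * real (card (I j))" if j: "j \<in> J" for j
  proof -
    have "(\<Sum>a\<in>{0..<m}. real (card (bad j a)))
        = (\<Sum>T\<in>I j. real (card {a\<in>{0..<m}. \<exists>u\<in>W T. \<exists>v\<in>W T. (u - a) div m \<noteq> (v - a) div m}))"
      unfolding bad_def using assms(2)[OF j] by (intro sum_card_swap) auto
    also have "\<dots> \<le> (\<Sum>T\<in>I j. l)"
      using assms(4,5)[OF j] assms(6,7) by (intro sum_mono card_crossing_shifts) blast+
    finally show ?thesis by (simp add: mult.commute)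
  qed
  have "(\<Sum>a\<in>{0..<m}. g a) = (\<Sum>j\<in>J. (\<Sum>a\<in>{0..<m}. real (card (bad j a))) / real (card (I j)))"
    unfolding g_def by (subst sum.swap) (simp add: sum_divide_distrib)
  also have "\<dots> \<le> (\<Sum>j\<in>J. l)"
    using swap Ipos by (intro sum_mono) (simp add: divide_le_eq)
  finally have tot: "(\<Sum>a\<in>{0..<m}. g a) \<le> real (card J) * l" by simp
  obtain a where a: "a \<in> {0..<m}" "g a \<le> real (card J) * l / real_of_int m"
  proof (rule ccontr)
    assume "\<not> thesis"
    then have "\<forall>a\<in>{0..<m}. real (card J) * l / real_of_int m < g a" using that by force
    then have "(\<Sum>a\<in>{0..<m}. real (card J) * l / real_of_int m) < (\<Sum>a\<in>{0..<m}. g a)"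
      using \<open>0 < m\<close> by (intro sum_strict_mono) auto
    then show False using tot \<open>0 < m\<close> by simp
  qed
  have "real (card (bad j a)) \<le> real (card J) * l / real_of_int m * real (card (I j))" if j: "j \<in> J" for j
  proof -
    have "real (card (bad j a)) / real (card (I j)) \<le> g a"
      unfolding g_def using assms(1) j by (intro member_le_sum) auto
    then have "real (card (bad j a)) / real (card (I j)) \<le> real (card J) * l / real_of_int m"
      using a(2) by linarith
    then show ?thesis using Ipos[OF j] by (simp only: pos_divide_le_eq)
  qed
  then show ?thesis unfolding bad_def by blast
qed

lemma div_diff_le_1:
  fixes u v m :: int
  assumes "0 < m" "\<bar>u - v\<bar> \<le> m"
  shows "\<bar>u div m - v div m\<bar> \<le> 1"
proof -
  have "u div m \<le> (v + m) div m" "v div m \<le> (u + m) div m"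
    by (rule zdiv_mono1; use assms in linarith)+
  moreover have "(w + m) div m = w div m + 1" for w using assms by simp
  ultimately show ?thesis by (simp add: abs_le_iff)
qed

text \<open>The columns in direction \<open>j\<close> are the block indices with the \<open>j\<close>-th coordinate erased. A tube that
  crosses no wall transversal to the other axes stays in one column. A tube that does cross one
  still moves by at most one block in each coordinate, hence meets at most \<open>3\<close> to the power of the
  dimension many columns.\<close>
lemma sum_card_columns_le:
  fixes I :: "'t set" and S :: "'t \<Rightarrow> ('i::finite \<Rightarrow> int) set"
  assumes "finite I" "0 < m" "finite C"
    and range: "\<And>T x y i. T \<in> I \<Longrightarrow> x \<in> S T \<Longrightarrow> y \<in> S T \<Longrightarrow> i \<noteq> j \<Longrightarrow> \<bar>x i - y i\<bar> \<le> m"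
  shows "(\<Sum>c\<in>C. real (card {T\<in>I. \<exists>x\<in>S T. (block m \<alpha> x)(j := undefined) = c}))
     \<le> real (card I) + 3 ^ CARD('i) *
        (\<Sum>i\<in>UNIV - {j}. real (card {T\<in>I. \<exists>x\<in>S T. \<exists>y\<in>S T. (x i - \<alpha> i) div m \<noteq> (y i - \<alpha> i) div m}))"
proof -
  define cross where "cross T i \<longleftrightarrow> (\<exists>x\<in>S T. \<exists>y\<in>S T. (x i - \<alpha> i) div m \<noteq> (y i - \<alpha> i) div m)" for T i
  define cols where "cols T = {c\<in>C. \<exists>x\<in>S T. (block m \<alpha> x)(j := undefined) = c}" for T
  have pt: "real (card (cols T)) \<le> 1 + 3 ^ CARD('i) * (\<Sum>i\<in>UNIV - {j}. if cross T i then 1 else 0)"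
    if T: "T \<in> I" for T
  proof (cases "\<exists>i\<in>UNIV - {j}. cross T i")
    case False
    have "card (cols T) \<le> Suc 0"
    proof (rule card_le_Suc0_iff_eq[THEN iffD2])
      show "finite (cols T)" using assms by (simp add: cols_def)
      show "\<forall>a1\<in>cols T. \<forall>a2\<in>cols T. a1 = a2"
      proof (intro ballI)
        fix a1 a2 assume "a1 \<in> cols T" "a2 \<in> cols T"
        then obtain x y where xy: "x \<in> S T" "y \<in> S T" "a1 = (block m \<alpha> x)(j := undefined)"
          "a2 = (block m \<alpha> y)(j := undefined)" by (auto simp: cols_def)
        have "(x i - \<alpha> i) div m = (y i - \<alpha> i) div m" if "i \<noteq> j" for i
          using False xy(1,2) that unfolding cross_def by blast
        then show "a1 = a2" unfolding xy by (auto simp: block_def)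
      qed
    qed
    then have "real (card (cols T)) \<le> 1" by simp
    moreover have "0 \<le> 3 ^ CARD('i) * (\<Sum>i\<in>UNIV - {j}. if cross T i then 1 else (0::real))"
      by (intro mult_nonneg_nonneg sum_nonneg) auto
    ultimately show ?thesis by linarith
  next
    case True
    then obtain i0 where i0: "i0 \<in> UNIV - {j}" "cross T i0" by blast
    then obtain x0 where x0: "x0 \<in> S T" by (auto simp: cross_def)
    define b where "b = block m \<alpha> x0"
    have "cols T \<subseteq> PiE (UNIV - {j}) (\<lambda>i. {b i - 1..b i + 1})"
    proof
      fix c assume "c \<in> cols T"
      then obtain x where x: "x \<in> S T" "c = (block m \<alpha> x)(j := undefined)" by (auto simp: cols_def)
      have "\<bar>block m \<alpha> x i - b i\<bar> \<le> 1" if "i \<noteq> j" for i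
        unfolding b_def block_def using range[OF T x(1) x0 that] assms
        by (intro div_diff_le_1) auto
      then show "c \<in> PiE (UNIV - {j}) (\<lambda>i. {b i - 1..b i + 1})"
        unfolding x PiE_iff by (force simp: abs_le_iff extensional_def)
    qed
    then have "card (cols T) \<le> card (PiE (UNIV - {j}) (\<lambda>i. {b i - 1..b i + 1}))"
      by (intro card_mono finite_PiE) auto
    also have "\<dots> = 3 ^ card (UNIV - {j} :: 'i set)" by (simp add: card_PiE)
    also have "\<dots> \<le> 3 ^ CARD('i)" by (intro power_increasing card_mono) auto
    finally have "real (card (cols T)) \<le> 3 ^ CARD('i)" by (simp flip: of_nat_le_iff)
    also have "\<dots> \<le> 3 ^ CARD('i) * (\<Sum>i\<in>UNIV - {j}. if cross T i then 1 else 0)"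
      using i0 member_le_sum[of i0 "UNIV - {j}" "\<lambda>i. if cross T i then 1 else (0::real)"] by auto
    finally show ?thesis by simp
  qed
  have "(\<Sum>c\<in>C. real (card {T\<in>I. \<exists>x\<in>S T. (block m \<alpha> x)(j := undefined) = c}))
      = (\<Sum>T\<in>I. real (card (cols T)))"
    unfolding cols_def using assms(1,3) by (intro sum_card_swap) auto
  also have "\<dots> \<le> (\<Sum>T\<in>I. 1 + 3 ^ CARD('i) * (\<Sum>i\<in>UNIV - {j}. if cross T i then 1 else 0))"
    by (intro sum_mono pt)
  also have "\<dots> = real (card I) + 3 ^ CARD('i) * (\<Sum>i\<in>UNIV - {j}. \<Sum>T\<in>I. if cross T i then 1 else 0)"
    by (subst sum.swap) (simp add: sum.distrib sum_distrib_left)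
  also have "(\<Sum>i\<in>UNIV - {j}. \<Sum>T\<in>I. if cross T i then 1 else (0::real))
      = (\<Sum>i\<in>UNIV - {j}. real (card {T\<in>I. cross T i}))"
    using assms(1) by (intro sum.cong refl) (simp add: sum.If_cases Int_def)
  finally show ?thesis unfolding cross_def .
qed

text \<open>The Kakeya inequality with cubes of side \<open>m\<close> as points, inside a region in which tubes deviate
  from their axis by at most \<open>l\<close>. A cube meets at most as many tubes as its column, and
  column counts do not depend on the \<open>j\<close>-th coordinate, so Loomis--Whitney applies. The sum of the column
  counts exceeds the number of tubes only through tubes that cross walls, so the constant tends
  to \<open>1\<close> when \<open>l / m\<close> tends to \<open>0\<close>. The translate is chosen separately in each coordinate.\<close>
lemma single_scale_kakeya:
  fixes I :: "'i::finite \<Rightarrow> 't set" and S :: "'t \<Rightarrow> ('i \<Rightarrow> int) set" and J :: "'i set"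
  assumes J: "2 \<le> card J" and fin: "\<And>j. j \<in> J \<Longrightarrow> finite (I j)" and ne: "\<And>j. j \<in> J \<Longrightarrow> I j \<noteq> {}"
    and V: "finite V" and "0 \<le> l" "l \<le> real_of_int m" "0 < m"
    and range: "\<And>j T x y i. j \<in> J \<Longrightarrow> T \<in> I j \<Longrightarrow> x \<in> S T \<inter> V \<Longrightarrow> y \<in> S T \<inter> V \<Longrightarrow> i \<noteq> j
       \<Longrightarrow> \<bar>real_of_int (x i - y i)\<bar> \<le> l"
  shows "\<exists>\<alpha>. (\<Sum>k\<in>block m \<alpha> ` V. \<Prod>j\<in>J.
        real (card {T\<in>I j. \<exists>x\<in>S T \<inter> V. block m \<alpha> x = k}) powr (1 / (real (card J) - 1)))
     \<le> (\<Prod>j\<in>J. (real (card (I j)) * (1 + real (card J) * real CARD('i) * 3 ^ CARD('i) * l / real_of_int m))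
           powr (1 / (real (card J) - 1)))"
proof -
  define n where "n = real (card J)"
  define cr where "cr T i a \<longleftrightarrow> (\<exists>x\<in>S T \<inter> V. \<exists>y\<in>S T \<inter> V. (x i - a) div m \<noteq> (y i - a) div m)" for T i a
  have "\<exists>a. \<forall>j\<in>J - {i}. real (card {T\<in>I j. cr T i a}) \<le> n * l / real_of_int m * real (card (I j))" for i
  proof -
    have "\<exists>a. \<forall>j\<in>J - {i}. real (card {T\<in>I j. \<exists>u\<in>(\<lambda>x. x i) ` (S T \<inter> V). \<exists>v\<in>(\<lambda>x. x i) ` (S T \<inter> V).
        (u - a) div m \<noteq> (v - a) div m}) \<le> real (card (J - {i})) * l / real_of_int m * real (card (I j))"
    proof (rule good_shift_exists)
      fix j T u v assume "j \<in> J - {i}" "T \<in> I j" "u \<in> (\<lambda>x. x i) ` (S T \<inter> V)" "v \<in> (\<lambda>x. x i) ` (S T \<inter> V)"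
      then obtain x y where "x \<in> S T \<inter> V" "y \<in> S T \<inter> V" "u = x i" "v = y i" "j \<in> J" "i \<noteq> j" by auto
      then show "real_of_int (v - u) \<le> l" using range[of j T y x i] \<open>T \<in> I j\<close> by linarith
    next
      show "finite (J - {i})" by simp
    qed (use fin ne V \<open>0 \<le> l\<close> \<open>0 < m\<close> in auto)
    then obtain a where a: "\<forall>j\<in>J - {i}. real (card {T\<in>I j. cr T i a})
        \<le> real (card (J - {i})) * l / real_of_int m * real (card (I j))"
      unfolding cr_def bex_simps by blast
    have "real (card (J - {i})) * l / real_of_int m * real (card (I j))
        \<le> n * l / real_of_int m * real (card (I j))" for j
      unfolding n_def using \<open>0 \<le> l\<close> \<open>0 < m\<close>
      by (intro mult_right_mono divide_right_mono) (auto intro: card_mono)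
    with a show ?thesis by (meson order_trans)
  qed
  then have "\<forall>i. \<exists>a. \<forall>j\<in>J - {i}. real (card {T\<in>I j. cr T i a}) \<le> n * l / real_of_int m * real (card (I j))"
    by blast
  from choice[OF this] obtain \<alpha> where \<alpha>0: "\<forall>i. \<forall>j\<in>J - {i}.
      real (card {T\<in>I j. cr T i (\<alpha> i)}) \<le> n * l / real_of_int m * real (card (I j))"
    by blast
  then have \<alpha>: "real (card {T\<in>I j. cr T i (\<alpha> i)}) \<le> n * l / real_of_int m * real (card (I j))"
    if "j \<in> J" "j \<noteq> i" for i j
    using that by simp
  define B where "B = block m \<alpha> ` V"
  define A where "A = (\<Union>k\<in>B. range k)"
  have finA: "finite A" "finite B" using V by (auto simp: A_def B_def)
  have BA: "B \<subseteq> PiE UNIV (\<lambda>_. A)" by (auto simp: A_def PiE_iff)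
  define f where "f j c = real (card {T\<in>I j. \<exists>x\<in>S T \<inter> V. (block m \<alpha> x)(j := undefined) = c})" for j c
  have colsum: "(\<Sum>c\<in>PiE (UNIV - {j}) (\<lambda>_. A). f j c)
      \<le> real (card (I j)) * (1 + n * real CARD('i) * 3 ^ CARD('i) * l / real_of_int m)" if j: "j \<in> J" for j
  proof -
    have "(\<Sum>c\<in>PiE (UNIV - {j}) (\<lambda>_. A). f j c) \<le> real (card (I j)) + 3 ^ CARD('i) *
        (\<Sum>i\<in>UNIV - {j}. real (card {T\<in>I j. cr T i (\<alpha> i)}))"
      unfolding f_def cr_def
    proof (rule sum_card_columns_le[where S = "\<lambda>T. S T \<inter> V"])
      fix T x y i assume "T \<in> I j" "x \<in> S T \<inter> V" "y \<in> S T \<inter> V" "i \<noteq> j"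
      then have "\<bar>real_of_int (x i - y i)\<bar> \<le> real_of_int m" using range[OF j, of T x y i] \<open>l \<le> real_of_int m\<close> by linarith
      then show "\<bar>x i - y i\<bar> \<le> m" by linarith
    qed (use fin j finA \<open>0 < m\<close> in \<open>auto intro!: finite_PiE\<close>)
    also have "\<dots> \<le> real (card (I j)) + 3 ^ CARD('i) *
        (\<Sum>i\<in>(UNIV - {j} :: 'i set). n * l / real_of_int m * real (card (I j)))"
      using \<alpha> j by (intro add_left_mono mult_left_mono sum_mono) auto
    also have "\<dots> \<le> real (card (I j)) + 3 ^ CARD('i) *
        (real CARD('i) * (n * l / real_of_int m * real (card (I j))))"
    proof (intro add_left_mono mult_left_mono)
      have "0 \<le> n * l / real_of_int m * real (card (I j))"
        using \<open>0 \<le> l\<close> \<open>0 < m\<close> by (simp add: n_def)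
      moreover have "card (UNIV - {j}) \<le> CARD('i)" by (intro card_mono) auto
      ultimately show "(\<Sum>i\<in>(UNIV - {j} :: 'i set). n * l / real_of_int m * real (card (I j)))
          \<le> real CARD('i) * (n * l / real_of_int m * real (card (I j)))"
        unfolding sum_constant by (intro mult_right_mono) auto
    qed simp
    also have "\<dots> = real (card (I j)) * (1 + n * real CARD('i) * 3 ^ CARD('i) * l / real_of_int m)"
      by (simp add: algebra_simps)
    finally show ?thesis .
  qed
  let ?e = "1 / (n - 1)"
  have e0: "?e \<ge> 0" using J by (simp add: n_def)
  have "(\<Sum>k\<in>B. \<Prod>j\<in>J. real (card {T\<in>I j. \<exists>x\<in>S T \<inter> V. block m \<alpha> x = k}) powr ?e)
     \<le> (\<Sum>k\<in>B. \<Prod>j\<in>J. f j (k(j := undefined)) powr ?e)"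
    unfolding f_def using e0 fin
    by (intro sum_mono prod_mono conjI powr_mono2 powr_ge_zero) (auto intro!: card_mono)
  also have "\<dots> \<le> (\<Sum>k\<in>PiE UNIV (\<lambda>_. A). \<Prod>j\<in>J. f j (k(j := undefined)) powr ?e)"
    using finA by (intro sum_mono2 BA finite_PiE prod_nonneg) auto
  also have "\<dots> \<le> (\<Prod>j\<in>J. (\<Sum>c\<in>PiE (UNIV - {j}) (\<lambda>_. A). f j c) powr ?e)"
    unfolding n_def using J finA by (intro discrete_Loomis_Whitney) (auto simp: f_def)
  also have "\<dots> \<le> (\<Prod>j\<in>J. (real (card (I j)) * (1 + n * real CARD('i) * 3 ^ CARD('i) * l / real_of_int m)) powr ?e)"
    using e0 colsum by (intro prod_mono conjI powr_mono2 powr_ge_zero) (auto simp: f_def intro!: sum_nonneg)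
  finally show ?thesis unfolding B_def n_def by blast
qed

section \<open>Far from and near a concentration cube\<close>

definition grid_box :: "('i \<Rightarrow> int) \<Rightarrow> nat \<Rightarrow> ('i \<Rightarrow> int) set" where
  "grid_box c \<rho> = {x. \<forall>i. c i \<le> x i \<and> x i < c i + int \<rho>}"

definition wide_box :: "('i \<Rightarrow> int) \<Rightarrow> nat \<Rightarrow> ('i \<Rightarrow> int) set" where
  "wide_box c \<rho> = {x. \<forall>i. \<bar>x i - c i\<bar> \<le> 4 * int \<rho>}"

lemma wide_box_eq_PiE: "wide_box c \<rho> = PiE UNIV (\<lambda>i. {c i - 4 * int \<rho>..c i + 4 * int \<rho>})"
proof (rule set_eqI)
  fix x :: "'a \<Rightarrow> int"
  have "\<bar>x i - c i\<bar> \<le> 4 * int \<rho> \<longleftrightarrow> x i \<in> {c i - 4 * int \<rho>..c i + 4 * int \<rho>}" for i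
    by auto
  then show "x \<in> wide_box c \<rho> \<longleftrightarrow> x \<in> PiE UNIV (\<lambda>i. {c i - 4 * int \<rho>..c i + 4 * int \<rho>})"
    by (simp add: wide_box_def PiE_iff del: atLeastAtMost_iff)
qed

lemma finite_wide_box: "finite (wide_box c \<rho> :: ('i::finite \<Rightarrow> int) set)"
  unfolding wide_box_eq_PiE by (intro finite_PiE) auto

lemma card_wide_box: "card (wide_box c \<rho> :: ('i::finite \<Rightarrow> int) set) = (8 * \<rho> + 1) ^ CARD('i)"
  unfolding wide_box_eq_PiE by (simp add: card_PiE algebra_simps nat_add_distrib nat_mult_distrib)

lemma abs_real_of_int_le: "\<bar>k\<bar> \<le> int m \<longleftrightarrow> \<bar>real_of_int k\<bar> \<le> real m"
proof -
  have "\<bar>real_of_int k\<bar> \<le> real m \<longleftrightarrow> real_of_int \<bar>k\<bar> \<le> real_of_int (int m)" by simp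
  then show ?thesis by (simp only: of_int_le_iff)
qed

text \<open>This is transversality. Let \<open>y\<close> and \<open>y'\<close> be the points of the box on the two sets. Along the
  first set the displacement of \<open>q\<close> is mainly in coordinate \<open>j\<close>, along the second mainly in
  coordinate \<open>k\<close>. As \<open>y\<close> and \<open>y'\<close> are within \<open>\<rho>\<close> of each other, each of these two coordinates is at most
  a quarter of the other plus a multiple of \<open>\<rho>\<close>, so both are bounded by a multiple of \<open>\<rho>\<close>.\<close>
lemma tubes_through_common_box_meet_nearby:
  fixes \<theta> w :: real
  assumes T: "thin \<theta> w j T" and T': "thin \<theta> w k T'" and "j \<noteq> k"
    and \<theta>: "0 \<le> \<theta>" "\<theta> \<le> 1/4" and w: "w \<le> real \<rho>"
    and q: "q \<in> T" "q \<in> T'"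
    and y: "y \<in> T" "y \<in> grid_box c \<rho>" and y': "y' \<in> T'" "y' \<in> grid_box c \<rho>"
  shows "q \<in> wide_box c \<rho>"
proof -
  define D where "D i = \<bar>real_of_int (q i - y i)\<bar>" for i
  define E where "E i = \<bar>real_of_int (q i - y' i)\<bar>" for i
  have yc: "\<bar>real_of_int (y i - c i)\<bar> \<le> real \<rho>" for i
  proof -
    have "c i \<le> y i" "y i < c i + int \<rho>" using y(2) by (auto simp: grid_box_def)
    then show ?thesis by (intro abs_real_of_int_le[THEN iffD1]) simp
  qed
  have DE: "D i \<le> E i + real \<rho>" "E i \<le> D i + real \<rho>" for i
  proof -
    have "c i \<le> y i" "y i < c i + int \<rho>" "c i \<le> y' i" "y' i < c i + int \<rho>"
      using y(2) y'(2) by (auto simp: grid_box_def)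
    then have "\<bar>real_of_int (y i - y' i)\<bar> \<le> real \<rho>"
      by (intro abs_real_of_int_le[THEN iffD1]) simp
    then show "D i \<le> E i + real \<rho>" "E i \<le> D i + real \<rho>" unfolding D_def E_def by auto
  qed
  have \<theta>4: "\<theta> * a \<le> a / 4" if "0 \<le> a" for a
    using mult_right_mono[OF \<theta>(2) that] by simp
  have nn: "0 \<le> D i" "0 \<le> E i" for i by (auto simp: D_def E_def)
  have Di: "D i \<le> \<theta> * D j + w" if "i \<noteq> j" for i
    using T q(1) y(1) that unfolding thin_def D_def by blast
  have Ej: "E j \<le> \<theta> * E k + w"
    using T' q(2) y'(1) \<open>j \<noteq> k\<close> unfolding thin_def E_def by blast
  have "D k \<le> D j / 4 + real \<rho>" using Di[of k] \<open>j \<noteq> k\<close> \<theta>4[OF nn(1)[of j]] w by simp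
  moreover have "E j \<le> E k / 4 + real \<rho>" using Ej \<theta>4[OF nn(2)[of k]] w by simp
  ultimately have Dj: "D j \<le> 3 * real \<rho>" using DE(1)[of j] DE(2)[of k] by linarith
  have Di3: "D i \<le> 3 * real \<rho>" for i
  proof (cases "i = j")
    case False
    then show ?thesis using Di[of i] \<theta>4[OF nn(1)[of j]] w Dj by linarith
  qed (use Dj in simp)
  have "\<bar>real_of_int (q i - c i)\<bar> \<le> real (4 * \<rho>)" for i
  proof -
    have "q i - c i = (q i - y i) + (y i - c i)" by simp
    then have "\<bar>real_of_int (q i - c i)\<bar> \<le> D i + \<bar>real_of_int (y i - c i)\<bar>"
      unfolding D_def by (metis abs_triangle_ineq of_int_add)
    also have "\<dots> \<le> 3 * real \<rho> + real \<rho>" using Di3 yc by (intro add_mono)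
    finally show ?thesis by simp
  qed
  then have "\<bar>q i - c i\<bar> \<le> int (4 * \<rho>)" for i
    unfolding abs_real_of_int_le .
  then show ?thesis by (simp add: wide_box_def)
qed

text \<open>The competition between the gain \<open>1 - (1 - s)\<^bsup>h\<^esup>\<close>, which is linear in \<open>s\<close> as \<open>s\<close> tends to \<open>0\<close>,
  and the superlinear loss is won for small \<open>s\<close>.\<close>
lemma concentration_threshold:
  fixes h \<eta> n :: real
  assumes "0 < h" "0 < \<eta>" "1 \<le> n"
  obtains s where "0 < s" "s < 1" "(1 - s) powr h + n * s powr (1 + \<eta>) < 1"
proof -
  define e where "e = min h 1"
  have e: "0 < e" "e \<le> 1" "e \<le> h" using assms by (auto simp: e_def)
  define s where "s = (e / (2 * n)) powr (1 / \<eta>)"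
  have base: "0 < e / (2 * n)" "e / (2 * n) < 1" using e assms by (auto simp: divide_simps)
  have s: "0 < s" "s < 1"
    using base assms powr_less_mono2[of "1/\<eta>" "e / (2 * n)" 1] by (auto simp: s_def)
  have s\<eta>: "s powr \<eta> = e / (2 * n)" using base assms e(1) by (simp add: s_def powr_powr)
  have "(1 - s) powr h \<le> (1 - s) powr e" using s e by (intro powr_mono') auto
  also have "\<dots> = (1 - s) powr e * 1 powr (1 - e)" by simp
  also have "\<dots> \<le> e * (1 - s) + (1 - e) * 1" using s e by (intro Youngs_inequality_0) auto
  finally have 1: "(1 - s) powr h \<le> 1 - e * s" by (simp add: algebra_simps)
  have "n * s powr (1 + \<eta>) = e * s / 2" using s assms by (simp add: powr_add s\<eta>)
  moreover have "e * s > 0" using e s by simp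
  ultimately have "(1 - s) powr h + n * s powr (1 + \<eta>) < 1" using 1 by linarith
  with s show ?thesis using that by blast
qed

text \<open>For each far point there is a family \<open>j\<close> such that, in all other families, the tubes through the
  point miss the box. As \<open>j\<close> depends on the point, the bound sums over all choices.\<close>
lemma sum_far_from_box_le:
  fixes I :: "'i::finite \<Rightarrow> 't set" and J :: "'i set"
  assumes "finite X" "\<And>j. j \<in> J \<Longrightarrow> finite (I j)" "2 \<le> card J"
    and thin: "\<And>j T. j \<in> J \<Longrightarrow> T \<in> I j \<Longrightarrow> thin \<theta> w j (S T)"
    and \<theta>: "0 \<le> \<theta>" "\<theta> \<le> 1/4" and w: "w \<le> real \<rho>"
    and far: "X \<inter> wide_box c \<rho> = {}"
  shows "(\<Sum>q\<in>X. \<Prod>i\<in>J. real (card (hits S (I i) {q})) powr p)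
    \<le> (\<Sum>j\<in>J. \<Sum>q\<in>X. \<Prod>i\<in>J.
        real (card (hits S (if i = j then I i else I i - hits S (I i) (grid_box c \<rho>)) {q})) powr p)"
proof -
  have pt: "(\<Prod>i\<in>J. real (card (hits S (I i) {q})) powr p)
    \<le> (\<Sum>j\<in>J. \<Prod>i\<in>J.
        real (card (hits S (if i = j then I i else I i - hits S (I i) (grid_box c \<rho>)) {q})) powr p)"
    if q: "q \<in> X" for q
  proof -
    define g where "g j = (\<Prod>i\<in>J.
        real (card (hits S (if i = j then I i else I i - hits S (I i) (grid_box c \<rho>)) {q})) powr p)" for j
    have "\<exists>j\<in>J. \<forall>i\<in>J - {j}. hits S (I i) {q} \<inter> hits S (I i) (grid_box c \<rho>) = {}"
    proof (rule ccontr)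
      assume no: "\<not> ?thesis"
      have "J \<noteq> {}" using assms by auto
      then obtain j0 where "j0 \<in> J" by blast
      have no': "\<exists>i\<in>J. i \<noteq> j \<and> hits S (I i) {q} \<inter> hits S (I i) (grid_box c \<rho>) \<noteq> {}" if "j \<in> J" for j
        using no that by (metis DiffE insertI1)
      from no'[OF \<open>j0 \<in> J\<close>] obtain j
        where j: "j \<in> J" "hits S (I j) {q} \<inter> hits S (I j) (grid_box c \<rho>) \<noteq> {}" by metis
      from no'[OF j(1)] obtain k
        where k: "k \<in> J" "j \<noteq> k" "hits S (I k) {q} \<inter> hits S (I k) (grid_box c \<rho>) \<noteq> {}" by metis
      obtain T y where T: "T \<in> I j" "q \<in> S T" "y \<in> S T" "y \<in> grid_box c \<rho>"
        using j unfolding hits_def by auto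
      obtain T' y' where T': "T' \<in> I k" "q \<in> S T'" "y' \<in> S T'" "y' \<in> grid_box c \<rho>"
        using k unfolding hits_def by auto
      have "q \<in> wide_box c \<rho>"
        using tubes_through_common_box_meet_nearby[OF thin[OF j(1) T(1)] thin[OF k(1) T'(1)] k(2) \<theta> w] T T' by blast
      then show False using far q by blast
    qed
    then obtain j where j: "j \<in> J" and dis: "\<And>i. i \<in> J \<Longrightarrow> i \<noteq> j \<Longrightarrow>
        hits S (I i) {q} \<inter> hits S (I i) (grid_box c \<rho>) = {}" by (metis DiffI singletonD)
    have eq: "hits S (if i = j then I i else I i - hits S (I i) (grid_box c \<rho>)) {q} = hits S (I i) {q}"
      if "i \<in> J" for i
    proof (cases "i = j")
      case False
      then show ?thesis using dis[OF that False] unfolding hits_def by auto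
    qed simp
    then have "(\<Prod>i\<in>J. real (card (hits S (I i) {q})) powr p) = g j"
      unfolding g_def by (intro prod.cong refl) (simp only: eq)
    also have "\<dots> \<le> sum g J"
      using j by (intro member_le_sum) (auto simp: g_def intro: prod_nonneg)
    finally have "(\<Prod>i\<in>J. real (card (hits S (I i) {q})) powr p) \<le> sum g J" .
    then show ?thesis unfolding g_def .
  qed
  have "(\<Sum>q\<in>X. \<Prod>i\<in>J. real (card (hits S (I i) {q})) powr p)
    \<le> (\<Sum>q\<in>X. \<Sum>j\<in>J. \<Prod>i\<in>J.
        real (card (hits S (if i = j then I i else I i - hits S (I i) (grid_box c \<rho>)) {q})) powr p)"
    by (intro sum_mono pt)
  also have "\<dots> = (\<Sum>j\<in>J. \<Sum>q\<in>X. \<Prod>i\<in>J.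
        real (card (hits S (if i = j then I i else I i - hits S (I i) (grid_box c \<rho>)) {q})) powr p)"
    by (rule sum.swap)
  finally show ?thesis .
qed

text \<open>The bound inside a region \<open>V\<close>, when no cube of side \<open>m\<close> meets a proportion \<open>1 - s\<close> of every
  family. The inequality with constant \<open>C\<close>, assumed for all proper subfamilies, is applied in every cube
  \<open>k\<close> of the grid to the families \<open>Ik k\<close> of tubes that meet it. In the resulting products
  the part of the exponent up to \<open>1 / (card J - 1)\<close> is summed by \<open>single_scale_kakeya\<close>, and the
  remaining part \<open>h\<close> produces the gain \<open>(1 - s)\<^bsup>h\<^esup>\<close>.\<close>
lemma sum_near_box_le:
  fixes I :: "'i::finite \<Rightarrow> 't set" and S :: "'t \<Rightarrow> ('i \<Rightarrow> int) set" and J :: "'i set"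
  assumes J: "2 \<le> card J" and fin: "\<And>j. j \<in> J \<Longrightarrow> finite (I j)" and ne: "\<And>j. j \<in> J \<Longrightarrow> I j \<noteq> {}"
    and V: "finite V" and l: "0 \<le> l" "l \<le> real m" and m: "0 < m"
    and range: "\<And>j T x y i. j \<in> J \<Longrightarrow> T \<in> I j \<Longrightarrow> x \<in> S T \<inter> V \<Longrightarrow> y \<in> S T \<inter> V \<Longrightarrow> i \<noteq> j
       \<Longrightarrow> \<bar>real_of_int (x i - y i)\<bar> \<le> l"
    and \<tau>: "real (card J) * real CARD('i) * 3 ^ CARD('i) * l / real m \<le> \<tau>"
    and p: "p = 1 / (real (card J) - 1) + h" "0 \<le> h" and s: "0 \<le> s" "s \<le> 1" and C: "0 \<le> C"
    and sparse: "\<And>c. \<exists>j\<in>J. real (card (hits S (I j) (grid_box c m))) < (1 - s) * real (card (I j))"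
    and IH: "\<And>I' X. (\<And>j. j \<in> J \<Longrightarrow> I' j \<subseteq> I j) \<Longrightarrow> (\<exists>j\<in>J. I' j \<noteq> I j) \<Longrightarrow> finite X \<Longrightarrow>
       (\<Sum>q\<in>X. \<Prod>j\<in>J. real (card (hits S (I' j) {q})) powr p) \<le> C * (\<Prod>j\<in>J. real (card (I' j)) powr p)"
  shows "(\<Sum>q\<in>X \<inter> V. \<Prod>j\<in>J. real (card (hits S (I j) {q})) powr p)
     \<le> C * ((1 - s) powr h * (1 + \<tau>)\<^sup>2) * (\<Prod>j\<in>J. real (card (I j)) powr p)"
proof -
  define n where "n = real (card J)"
  define e where "e = 1 / (n - 1)"
  have n2: "2 \<le> n" and e: "0 \<le> e" "e * n \<le> 2" using J by (auto simp: n_def e_def field_simps)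
  have p0: "0 \<le> p" and pe: "p = e + h" using p e by (auto simp: e_def n_def)
  have \<tau>0: "0 \<le> \<tau>" using \<tau> l m by (smt (verit) divide_nonneg_nonneg mult_nonneg_nonneg of_nat_0_le_iff zero_le_power)
  have "\<exists>\<alpha>. (\<Sum>k\<in>block (int m) \<alpha> ` V. \<Prod>j\<in>J.
        real (card {T\<in>I j. \<exists>x\<in>S T \<inter> V. block (int m) \<alpha> x = k}) powr (1 / (real (card J) - 1)))
     \<le> (\<Prod>j\<in>J. (real (card (I j)) * (1 + real (card J) * real CARD('i) * 3 ^ CARD('i) * l / real_of_int (int m)))
           powr (1 / (real (card J) - 1)))"
    using J V l m by (intro single_scale_kakeya) (simp_all add: fin ne range del: of_int_diff)
  then obtain \<alpha> where \<alpha>: "(\<Sum>k\<in>block (int m) \<alpha> ` V. \<Prod>j\<in>J.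
        real (card {T\<in>I j. \<exists>x\<in>S T \<inter> V. block (int m) \<alpha> x = k}) powr (1 / (real (card J) - 1)))
     \<le> (\<Prod>j\<in>J. (real (card (I j)) * (1 + real (card J) * real CARD('i) * 3 ^ CARD('i) * l / real m))
           powr (1 / (real (card J) - 1)))"
    by auto
  define \<beta> where "\<beta> = block (int m) \<alpha>"
  define Ik where "Ik k j = {T\<in>I j. \<exists>x\<in>S T \<inter> V. \<beta> x = k}" for k j
  define N where "N j = real (card (I j))" for j
  have N0: "0 \<le> N j" for j by (simp add: N_def)
  have IkN: "real (card (Ik k j)) \<le> N j" if "j \<in> J" for k j
    unfolding N_def Ik_def using fin[OF that] by (auto intro: card_mono)
  have conc: "\<exists>j\<in>J. real (card (Ik k j)) < (1 - s) * N j" for k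
  proof -
    define c where "c i = int m * k i + \<alpha> i" for i
    have sub: "{x. \<beta> x = k} \<subseteq> grid_box c m"
    proof
      fix x assume "x \<in> {x. \<beta> x = k}"
      then have k: "k i = (x i - \<alpha> i) div int m" for i by (auto simp: \<beta>_def block_def)
      have "c i \<le> x i \<and> x i < c i + int m" for i
        using mult_div_mod_eq[of "int m" "x i - \<alpha> i"] pos_mod_sign[of "int m" "x i - \<alpha> i"]
          pos_mod_bound[of "int m" "x i - \<alpha> i"] m unfolding c_def k by linarith
      then show "x \<in> grid_box c m" by (simp add: grid_box_def)
    qed
    obtain j where j: "j \<in> J" "real (card (hits S (I j) (grid_box c m))) < (1 - s) * N j"
      using sparse[of c] unfolding N_def by blast
    have "Ik k j \<subseteq> hits S (I j) (grid_box c m)" using sub by (auto simp: Ik_def hits_def)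
    then have "card (Ik k j) \<le> card (hits S (I j) (grid_box c m))"
      using fin[OF j(1)] by (intro card_mono) (auto simp: hits_def)
    then show ?thesis using j by force
  qed
  have blk: "(\<Sum>q\<in>{q \<in> X \<inter> V. \<beta> q = k}. \<Prod>j\<in>J. real (card (hits S (I j) {q})) powr p)
      \<le> C * ((\<Prod>j\<in>J. real (card (Ik k j)) powr e) * ((1 - s) powr h * (\<Prod>j\<in>J. N j powr h)))" for k
  proof -
    have eq: "hits S (I j) {q} = hits S (Ik k j) {q}" if "q \<in> V" "\<beta> q = k" for q j
      using that by (auto simp: hits_def Ik_def)
    obtain j0 where j0: "j0 \<in> J" "real (card (Ik k j0)) < (1 - s) * N j0" using conc by blast
    then have "real (card (Ik k j0)) < N j0" using s N0[of j0] by (smt (verit) mult_left_le_one_le)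
    then have ne0: "Ik k j0 \<noteq> I j0" by (auto simp: N_def)
    have "(\<Sum>q\<in>{q \<in> X \<inter> V. \<beta> q = k}. \<Prod>j\<in>J. real (card (hits S (I j) {q})) powr p)
        = (\<Sum>q\<in>{q \<in> X \<inter> V. \<beta> q = k}. \<Prod>j\<in>J. real (card (hits S (Ik k j) {q})) powr p)"
      by (intro sum.cong prod.cong refl) (simp add: eq)
    also have "\<dots> \<le> C * (\<Prod>j\<in>J. real (card (Ik k j)) powr p)"
      using V j0(1) ne0 by (intro IH) (auto simp: Ik_def)
    also have "(\<Prod>j\<in>J. real (card (Ik k j)) powr p)
        = (\<Prod>j\<in>J. real (card (Ik k j)) powr e) * (\<Prod>j\<in>J. real (card (Ik k j)) powr h)"
      by (simp add: pe powr_add prod.distrib)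
    also have "(\<Prod>j\<in>J. real (card (Ik k j)) powr h) \<le> (1 - s) powr h * (\<Prod>j\<in>J. N j powr h)"
    proof -
      have "(\<Prod>j\<in>J. real (card (Ik k j)) powr h)
          = real (card (Ik k j0)) powr h * (\<Prod>j\<in>J - {j0}. real (card (Ik k j)) powr h)"
        using j0 by (simp add: prod.remove)
      also have "\<dots> \<le> ((1 - s) * N j0) powr h * (\<Prod>j\<in>J - {j0}. N j powr h)"
        using j0 p(2) IkN by (intro mult_mono prod_mono conjI powr_mono2) (auto intro!: prod_nonneg)
      also have "\<dots> = (1 - s) powr h * (\<Prod>j\<in>J. N j powr h)"
        using j0 s N0 by (simp add: prod.remove powr_mult)
      finally show ?thesis .
    qed
    finally show ?thesis using C by (simp add: mult_left_mono prod_nonneg)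
  qed
  have "(\<Sum>q\<in>X \<inter> V. \<Prod>j\<in>J. real (card (hits S (I j) {q})) powr p)
     = (\<Sum>k\<in>\<beta> ` V. \<Sum>q\<in>{q \<in> X \<inter> V. \<beta> q = k}. \<Prod>j\<in>J. real (card (hits S (I j) {q})) powr p)"
    using V by (intro sum.group[symmetric]) auto
  also have "\<dots> \<le> (\<Sum>k\<in>\<beta> ` V. C * ((\<Prod>j\<in>J. real (card (Ik k j)) powr e) * ((1 - s) powr h * (\<Prod>j\<in>J. N j powr h))))"
    by (intro sum_mono blk)
  also have "\<dots> = C * ((1 - s) powr h * (\<Prod>j\<in>J. N j powr h)) * (\<Sum>k\<in>\<beta> ` V. \<Prod>j\<in>J. real (card (Ik k j)) powr e)"
    by (simp add: sum_distrib_left mult_ac)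
  also have "\<dots> \<le> C * ((1 - s) powr h * (\<Prod>j\<in>J. N j powr h)) * ((1 + \<tau>)\<^sup>2 * (\<Prod>j\<in>J. N j powr e))"
  proof (intro mult_left_mono)
    have "(\<Sum>k\<in>\<beta> ` V. \<Prod>j\<in>J. real (card (Ik k j)) powr e)
        \<le> (\<Prod>j\<in>J. (N j * (1 + n * real CARD('i) * 3 ^ CARD('i) * l / real m)) powr e)"
      using \<alpha> unfolding \<beta>_def Ik_def e_def n_def N_def by simp
    also have "\<dots> \<le> (\<Prod>j\<in>J. (N j * (1 + \<tau>)) powr e)"
      using \<tau> l e N0 unfolding n_def
      by (intro prod_mono conjI powr_mono2 mult_left_mono) (auto intro!: mult_nonneg_nonneg add_nonneg_nonneg)
    also have "\<dots> = (1 + \<tau>) powr (e * n) * (\<Prod>j\<in>J. N j powr e)"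
    proof -
      have "(1 + \<tau>) powr (e * n) = ((1 + \<tau>) powr e) ^ card J"
        using \<tau>0 by (simp add: n_def powr_powr[symmetric] powr_realpow)
      then show ?thesis using N0 \<tau>0 by (simp add: powr_mult prod.distrib mult.commute)
    qed
    also have "\<dots> \<le> (1 + \<tau>) powr 2 * (\<Prod>j\<in>J. N j powr e)"
      using \<tau>0 e by (intro mult_right_mono powr_mono prod_nonneg) auto
    finally show "(\<Sum>k\<in>\<beta> ` V. \<Prod>j\<in>J. real (card (Ik k j)) powr e) \<le> (1 + \<tau>)\<^sup>2 * (\<Prod>j\<in>J. N j powr e)"
      using \<tau>0 by simp
  qed (use C in \<open>auto intro!: mult_nonneg_nonneg prod_nonneg\<close>)
  also have "\<dots> = C * ((1 - s) powr h * (1 + \<tau>)\<^sup>2) * (\<Prod>j\<in>J. N j powr p)"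
    by (simp add: pe powr_add prod.distrib mult_ac)
  finally show ?thesis by (simp add: N_def)
qed

text \<open>This makes the choice of a smallest concentration cube legitimate.\<close>
lemma concentrated_box_exists:
  fixes I :: "'i::finite \<Rightarrow> 't set" and S :: "'t \<Rightarrow> ('i \<Rightarrow> int) set"
  assumes "finite J" "\<And>j. j \<in> J \<Longrightarrow> finite (I j)" "\<And>j T. j \<in> J \<Longrightarrow> T \<in> I j \<Longrightarrow> S T \<noteq> {}"
  shows "\<exists>\<rho> c. \<forall>j\<in>J. hits S (I j) (grid_box c \<rho>) = I j"
proof -
  define P where "P = (\<lambda>T. SOME x. x \<in> S T) ` (\<Union>j\<in>J. I j)"
  have finP: "finite P" using assms by (auto simp: P_def)
  define M where "M = nat (Max (insert 0 ((\<lambda>(x, i). \<bar>x i\<bar>) ` (P \<times> UNIV))))"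
  have M: "\<bar>x i\<bar> \<le> int M" if "x \<in> P" for x i
  proof -
    have "\<bar>x i\<bar> \<le> Max (insert 0 ((\<lambda>(x, i). \<bar>x i\<bar>) ` (P \<times> UNIV)))"
      using finP that by (intro Max_ge) auto
    then show ?thesis unfolding M_def by linarith
  qed
  have "hits S (I j) (grid_box (\<lambda>_. - int M) (2 * M + 1)) = I j" if j: "j \<in> J" for j
  proof -
    have "S T \<inter> grid_box (\<lambda>_. - int M) (2 * M + 1) \<noteq> {}" if T: "T \<in> I j" for T
    proof -
      define x where "x = (SOME x. x \<in> S T)"
      have "x \<in> P" using T j by (auto simp: P_def x_def)
      have "x \<in> S T" unfolding x_def using assms(3)[OF j T] by (simp add: some_in_eq)
      moreover have "x \<in> grid_box (\<lambda>_. - int M) (2 * M + 1)"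
      proof -
        have "- int M \<le> x i \<and> x i < - int M + int (2 * M + 1)" for i
          using M[OF \<open>x \<in> P\<close>, of i] by (simp add: abs_le_iff)
        then show ?thesis by (simp add: grid_box_def)
      qed
      ultimately show ?thesis by blast
    qed
    then show ?thesis by (auto simp: hits_def)
  qed
  then show ?thesis by blast
qed

section \<open>The discrete multilinear Kakeya inequality\<close>

text \<open>The inequality is scale free, since neither \<open>\<theta>\<close> nor \<open>C\<close> depends on the extent of the sets. The
  induction is on the total number of tubes. The scale \<open>R\<close> below is that at which the thickness \<open>w\<close> is
  negligible; concentration below this scale is handled by counting points.\<close>
theorem discrete_multilinear_kakeya:
  fixes J :: "'i::finite set" and p w :: real
  assumes J: "2 \<le> card J" and p: "1 / (real (card J) - 1) < p" and w: "0 \<le> w"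
  shows "\<exists>\<theta>>0. \<exists>C\<ge>0. \<forall>(S :: 't \<Rightarrow> ('i \<Rightarrow> int) set) I X.
      finite X \<longrightarrow> (\<forall>j\<in>J. finite (I j)) \<longrightarrow> (\<forall>j\<in>J. \<forall>T\<in>I j. S T \<noteq> {} \<and> thin \<theta> w j (S T)) \<longrightarrow>
      (\<Sum>q\<in>X. \<Prod>j\<in>J. real (card (hits S (I j) {q})) powr p) \<le> C * (\<Prod>j\<in>J. real (card (I j)) powr p)"
proof -
  define n where "n = real (card J)"
  define h where "h = p - 1 / (n - 1)"
  define \<eta> where "\<eta> = (n - 1) * h"
  have n2: "2 \<le> n" using J by (simp add: n_def)
  have h: "0 < h" and \<eta>: "0 < \<eta>" using p n2 by (auto simp: h_def \<eta>_def n_def)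
  have p\<eta>: "(n - 1) * p = 1 + \<eta>" using n2 by (simp add: \<eta>_def h_def field_simps)
  have p0: "0 < p"
  proof -
    have "0 \<le> 1 / (real (card J) - 1)" using J by simp
    then show ?thesis using p by linarith
  qed
  obtain s where s: "0 < s" "s < 1" and gap: "(1 - s) powr h + n * s powr (1 + \<eta>) < 1"
    using concentration_threshold[OF h \<eta>, of n] n2 by auto
  (* F is the relative loss from points far from the concentration cube, and G the room that is left
     for the loss 1 + \<tau> in passing from one scale to the next. *)
  define F where "F = n * s powr (1 + \<eta>)"
  define G where "G = 1 - (1 - s) powr h - F"
  have "0 \<le> (1 - s) powr h" by (rule powr_ge_zero)
  with gap have F: "0 \<le> F" "F < 1" and G: "0 < G" 
    using n2 unfolding F_def G_def by (simp, linarith, linarith)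
  define \<tau> where "\<tau> = min 1 (G / 3)"
  have \<tau>: "0 < \<tau>" "\<tau> \<le> 1" "3 * \<tau> \<le> G" using G by (auto simp: \<tau>_def)
  have contr: "(1 - s) powr h * (1 + \<tau>)\<^sup>2 + F \<le> 1"
  proof -
    have "(1 + \<tau>)\<^sup>2 \<le> 1 + 3 * \<tau>" using \<tau> by (simp add: power2_eq_square algebra_simps)
    then have "(1 - s) powr h * (1 + \<tau>)\<^sup>2 \<le> (1 - s) powr h * (1 + 3 * \<tau>)" by (simp add: mult_left_mono)
    also have "\<dots> = (1 - s) powr h + (1 - s) powr h * (3 * \<tau>)" by (simp add: algebra_simps)
    also have "\<dots> \<le> (1 - s) powr h + 1 * (3 * \<tau>)"
      using s h \<tau> by (intro add_left_mono mult_right_mono powr_le1) auto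
    finally show ?thesis using \<tau> by (simp add: G_def)
  qed
  define K where "K = n * real CARD('i) * 3 ^ CARD('i)"
  have K: "1 \<le> K"
  proof -
    have "1 * 1 \<le> n * real CARD('i)" using n2 by (intro mult_mono) auto
    then have "1 * 1 \<le> n * real CARD('i) * 3 ^ CARD('i)" by (intro mult_mono) auto
    then show ?thesis by (simp add: K_def)
  qed
  (* Inside the dilated cube of side 8\<rho> tubes deviate by l = 8\<theta>\<rho> + w, and blocks have side
     m = \<rho> - 1 \<ge> \<rho>/2. The choices of \<theta> and R make each of the two summands of K * l
     at most \<tau>\<rho>/4, hence K * l / m \<le> \<tau>. *)
  define \<theta> where "\<theta> = \<tau> / (32 * K)"
  have \<theta>: "0 < \<theta>" "\<theta> \<le> 1/4" using \<tau> K by (auto simp: \<theta>_def field_simps)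
  obtain R :: nat where R: "2 \<le> R" "w \<le> real R" "4 * K * w / \<tau> \<le> real R"
  proof -
    obtain R :: nat where "max 2 (max w (4 * K * w / \<tau>)) \<le> real R" using real_arch_simple by blast
    then show ?thesis using that[of R] by auto
  qed
  (* C solves C = (8R + 1)^d + C * F, the two contributions when the concentration cube is small. *)
  define C where "C = real ((8 * R + 1) ^ CARD('i)) / (1 - F)"
  have C0: "0 \<le> C" and CF: "real ((8 * R + 1) ^ CARD('i)) + C * F = C"
    using F by (auto simp: C_def field_simps)
  have main: "(\<Sum>q\<in>X. \<Prod>j\<in>J. real (card (hits S (I j) {q})) powr p) \<le> C * (\<Prod>j\<in>J. real (card (I j)) powr p)"
    if "finite X" "\<And>j. j \<in> J \<Longrightarrow> finite (I j)"
      "\<And>j T. j \<in> J \<Longrightarrow> T \<in> I j \<Longrightarrow> S T \<noteq> {} \<and> thin \<theta> w j (S T)"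
    for S :: "'t \<Rightarrow> ('i \<Rightarrow> int) set" and I X
    using that
  proof (induction "\<Sum>j\<in>J. card (I j)" arbitrary: I X rule: less_induct)
    case less
    note fin = less.prems(2)
    show ?case
    proof (cases "\<exists>j\<in>J. I j = {}")
      case True
      then obtain j where j: "j \<in> J" "I j = {}" by blast
      then have "(\<Prod>j\<in>J. real (card (hits S (I j) {q})) powr p) = 0" for q
        by (intro prod_zero) (auto simp: hits_def intro!: bexI[of _ j])
      then have "(\<Sum>q\<in>X. \<Prod>j\<in>J. real (card (hits S (I j) {q})) powr p) = 0" by (intro sum.neutral) blast
      then show ?thesis using C0 by (simp add: prod_nonneg)
    next
      case False
      then have ne: "I j \<noteq> {}" if "j \<in> J" for j using that by blast
      define N where "N j = real (card (I j))" for j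
      have N0: "0 < N j" if "j \<in> J" for j using ne[OF that] fin[OF that] by (simp add: N_def card_gt_0_iff)
      define PN where "PN = (\<Prod>j\<in>J. N j powr p)"
      have PN0: "0 \<le> PN" by (simp add: PN_def prod_nonneg)
      have IH: "(\<Sum>q\<in>X. \<Prod>j\<in>J. real (card (hits S (I' j) {q})) powr p) \<le> C * (\<Prod>j\<in>J. real (card (I' j)) powr p)"
        if sub: "\<And>j. j \<in> J \<Longrightarrow> I' j \<subseteq> I j" and neq: "\<exists>j\<in>J. I' j \<noteq> I j" and X: "finite X" for I' X
      proof (rule less.hyps)
        obtain j where j: "j \<in> J" "I' j \<noteq> I j" using neq by blast
        show "(\<Sum>j\<in>J. card (I' j)) < (\<Sum>j\<in>J. card (I j))"
        proof (rule sum_strict_mono_ex1)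
          show "\<forall>j\<in>J. card (I' j) \<le> card (I j)" using sub fin by (auto intro: card_mono)
          show "\<exists>j\<in>J. card (I' j) < card (I j)" using j sub fin by (auto intro!: bexI[of _ j] psubset_card_mono)
        qed simp
        show "finite (I' j)" if "j \<in> J" for j using sub[OF that] fin[OF that] finite_subset by blast
        show "S T \<noteq> {} \<and> thin \<theta> w j (S T)" if "j \<in> J" "T \<in> I' j" for j T
          using sub that less.prems(3) by blast
      qed (fact X)
      define conc where "conc \<rho> c \<longleftrightarrow> (\<forall>j\<in>J. (1 - s) * N j \<le> real (card (hits S (I j) (grid_box c \<rho>))))" for \<rho> c
      have ex: "\<exists>\<rho>. \<exists>c. conc \<rho> c"
      proof -
        obtain \<rho> c where c: "\<And>j. j \<in> J \<Longrightarrow> hits S (I j) (grid_box c \<rho>) = I j"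
          using concentrated_box_exists[of J I S] fin less.prems(3) by (metis finite_class.finite)
        have "conc \<rho> c" unfolding conc_def
          using s by (auto simp: c N_def intro!: mult_left_le_one_le)
        then show ?thesis by blast
      qed
      define \<rho> where "\<rho> = (LEAST \<rho>. \<exists>c. conc \<rho> c)"
      obtain c where c: "conc \<rho> c" using LeastI_ex[OF ex] unfolding \<rho>_def by blast
      have minimal: "\<not> conc \<rho>' c'" if "\<rho>' < \<rho>" for \<rho>' c'
        using not_less_Least[of \<rho>' "\<lambda>\<rho>. \<exists>c. conc \<rho> c"] that unfolding \<rho>_def by blast
      \<comment> \<open>Below the scale \<open>R\<close> the box is enlarged, so that the thickness \<open>w\<close> never exceeds the size of the box.\<close>
      define r where "r = max \<rho> R"
      define V where "V = wide_box c r"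
      define Q where "Q = grid_box c r"
      have finV: "finite V" by (simp add: V_def finite_wide_box)
      have "int \<rho> \<le> int r" by (simp add: r_def)
      then have "grid_box c \<rho> \<subseteq> Q" unfolding Q_def grid_box_def by (auto intro: less_le_trans)
      then have concQ: "(1 - s) * N j \<le> real (card (hits S (I j) Q))" if "j \<in> J" for j
      proof -
        have "hits S (I j) (grid_box c \<rho>) \<subseteq> hits S (I j) Q"
          using \<open>grid_box c \<rho> \<subseteq> Q\<close> by (auto simp: hits_def)
        then have "card (hits S (I j) (grid_box c \<rho>)) \<le> card (hits S (I j) Q)"
          using fin[OF that] by (intro card_mono) (auto simp: hits_def)
        moreover have "(1 - s) * N j \<le> real (card (hits S (I j) (grid_box c \<rho>)))"
          using c that unfolding conc_def by blast
        ultimately show ?thesis by linarith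
      qed
      define I' where "I' j i = (if i = j then I i else I i - hits S (I i) Q)" for j i
      have I'card: "real (card (I' j i)) \<le> s * N i" if "i \<in> J" "i \<noteq> j" for i j
      proof -
        have "card (I i - hits S (I i) Q) = card (I i) - card (hits S (I i) Q)"
          using fin[OF that(1)] by (intro card_Diff_subset) (auto simp: hits_def)
        moreover have "card (hits S (I i) Q) \<le> card (I i)"
          using fin[OF that(1)] by (intro card_mono) (auto simp: hits_def)
        ultimately show ?thesis
          using concQ[OF that(1)] that(2) by (simp add: I'_def N_def of_nat_diff algebra_simps)
      qed
      (* Strictly fewer tubes: families other than j lose the tubes through Q, and there is such a
         family. The proportion s enters with total exponent (n - 1) p = 1 + \<eta>. *)
      have far1: "(\<Sum>q\<in>X - V. \<Prod>i\<in>J. real (card (hits S (I' j i) {q})) powr p) \<le> C * (s powr (1 + \<eta>) * PN)"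
        if j: "j \<in> J" for j
      proof -
        have "card (J - {j}) \<noteq> 0" using J j by (simp add: card_Diff_singleton)
        then obtain i where i: "i \<in> J" "i \<noteq> j" by (metis DiffD1 DiffD2 card.empty ex_in_conv singletonI)
        have "real (card (I' j i)) < N i"
          using I'card[OF i] N0[OF i(1)] s mult_strict_right_mono[OF s(2) N0[OF i(1)]] by simp
        then have "I' j i \<noteq> I i" by (auto simp: N_def)
        then have "(\<Sum>q\<in>X - V. \<Prod>i\<in>J. real (card (hits S (I' j i) {q})) powr p)
            \<le> C * (\<Prod>i\<in>J. real (card (I' j i)) powr p)"
          using i less.prems(1) by (intro IH) (auto simp: I'_def)
        also have "(\<Prod>i\<in>J. real (card (I' j i)) powr p)
            = N j powr p * (\<Prod>i\<in>J - {j}. real (card (I' j i)) powr p)"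
          using j by (simp add: prod.remove I'_def N_def)
        also have "\<dots> \<le> N j powr p * (\<Prod>i\<in>J - {j}. (s * N i) powr p)"
          using I'card p0 by (intro mult_left_mono prod_mono conjI powr_mono2) auto
        also have "\<dots> = (s powr p) ^ (card J - 1) * PN"
          using j s N0 by (simp add: PN_def prod.remove powr_mult prod.distrib less_imp_le card_Diff_singleton mult_ac)
        also have "(s powr p) ^ (card J - 1) = s powr (1 + \<eta>)"
          using s J p\<eta> by (simp add: powr_realpow[symmetric] powr_powr n_def of_nat_diff mult.commute)
        finally show ?thesis using C0 by (simp add: mult_left_mono)
      qed
      have far: "(\<Sum>q\<in>X - V. \<Prod>i\<in>J. real (card (hits S (I i) {q})) powr p) \<le> C * F * PN"
      proof -
        have "(\<Sum>q\<in>X - V. \<Prod>i\<in>J. real (card (hits S (I i) {q})) powr p)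
          \<le> (\<Sum>j\<in>J. \<Sum>q\<in>X - V. \<Prod>i\<in>J. real (card (hits S (I' j i) {q})) powr p)"
          unfolding I'_def Q_def
        proof (rule sum_far_from_box_le)
          show "w \<le> real r" using R(2) by (simp add: r_def)
          show "(X - V) \<inter> wide_box c r = {}" by (auto simp: V_def)
          show "thin \<theta> w j (S T)" if "j \<in> J" "T \<in> I j" for j T using less.prems(3)[OF that] by blast
        qed (use less.prems(1,2) J \<theta> in auto)
        also have "\<dots> \<le> (\<Sum>j\<in>J. C * (s powr (1 + \<eta>) * PN))" by (intro sum_mono far1)
        also have "\<dots> = C * F * PN" by (simp add: F_def n_def)
        finally show ?thesis .
      qed
      have near: "(\<Sum>q\<in>X \<inter> V. \<Prod>i\<in>J. real (card (hits S (I i) {q})) powr p) \<le> (C - C * F) * PN"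
      \<comment> \<open>At a tiny scale count points; otherwise cubes of side \<open>\<rho> - 1\<close> are not concentrated, by minimality of \<open>\<rho>\<close>.\<close>
      proof (cases "\<rho> \<le> R")
        case True
        have "(\<Sum>q\<in>X \<inter> V. \<Prod>i\<in>J. real (card (hits S (I i) {q})) powr p) \<le> (\<Sum>q\<in>X \<inter> V. PN)"
          unfolding PN_def N_def using p0 fin
          by (intro sum_mono prod_mono conjI powr_mono2) (auto simp: hits_def intro: card_mono)
        also have "\<dots> \<le> real (card V) * PN"
          using finV PN0 by (auto intro!: mult_right_mono card_mono)
        also have "card V = (8 * R + 1) ^ CARD('i)" using True by (simp add: V_def r_def card_wide_box)
        also have "real ((8 * R + 1) ^ CARD('i)) = C - C * F" using CF by linarith
        finally show ?thesis .
      next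
        case False
        define m where "m = \<rho> - 1"
        define l where "l = \<theta> * (8 * real \<rho>) + w"
        have \<rho>: "R < \<rho>" "r = \<rho>" using False by (auto simp: r_def)
        have m: "real \<rho> \<le> 2 * real m" "0 < m" "m < \<rho>" using \<rho> R(1) by (auto simp: m_def of_nat_diff)
        have Kl: "K * l \<le> \<tau> * real m"
        proof -
          have "K * l = \<tau> * real \<rho> / 4 + K * w" using K by (simp add: l_def \<theta>_def field_simps)
          moreover have "4 * K * w \<le> \<tau> * real R" using R(3) \<tau> by (simp add: field_simps)
          moreover have "\<tau> * real R \<le> \<tau> * real \<rho>" using \<rho> \<tau> by simp
          moreover have "\<tau> * real \<rho> \<le> \<tau> * (2 * real m)" using m \<tau> by (intro mult_left_mono) auto
          ultimately show ?thesis by linarith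
        qed
        have l0: "0 \<le> l" using \<theta> w by (simp add: l_def)
        have "l \<le> K * l" using K l0 by (simp add: mult_le_cancel_right1)
        moreover have "\<tau> * real m \<le> real m" using \<tau>(2) m(2) by simp
        ultimately have lm: "l \<le> real m" using Kl by linarith
        have "(\<Sum>q\<in>X \<inter> V. \<Prod>i\<in>J. real (card (hits S (I i) {q})) powr p)
          \<le> C * ((1 - s) powr h * (1 + \<tau>)\<^sup>2) * (\<Prod>j\<in>J. real (card (I j)) powr p)"
        proof (rule sum_near_box_le[where l = l and m = m, OF J fin ne finV l0 lm m(2)])
          show "\<bar>real_of_int (x i - y i)\<bar> \<le> l"
            if "j \<in> J" "T \<in> I j" "x \<in> S T \<inter> V" "y \<in> S T \<inter> V" "i \<noteq> j" for j T x y i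
          proof -
            have "\<bar>x j - c j\<bar> \<le> 4 * int \<rho>" "\<bar>y j - c j\<bar> \<le> 4 * int \<rho>"
              using that(3,4) \<rho>(2) by (auto simp: V_def wide_box_def)
            then have "\<bar>x j - y j\<bar> \<le> int (8 * \<rho>)" by linarith
            then have "\<bar>real_of_int (x j - y j)\<bar> \<le> 8 * real \<rho>" unfolding abs_real_of_int_le by simp
            then have "\<theta> * \<bar>real_of_int (x j - y j)\<bar> \<le> \<theta> * (8 * real \<rho>)" using \<theta> by (intro mult_left_mono) auto
            moreover have "\<bar>real_of_int (x i - y i)\<bar> \<le> \<theta> * \<bar>real_of_int (x j - y j)\<bar> + w"
              using less.prems(3)[OF that(1,2)] that(3-5) unfolding thin_def by blast
            ultimately show ?thesis unfolding l_def by linarith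
          qed
          show "real (card J) * real CARD('i) * 3 ^ CARD('i) * l / real m \<le> \<tau>"
            using Kl m(2) by (simp add: K_def n_def pos_divide_le_eq)
          show "p = 1 / (real (card J) - 1) + h" by (simp add: h_def n_def)
          show "\<exists>j\<in>J. real (card (hits S (I j) (grid_box c' m))) < (1 - s) * real (card (I j))" for c'
            using minimal[OF m(3), of c'] unfolding conc_def N_def by (meson not_le)
        qed (use h s C0 IH in auto)
        also have "\<dots> = C * ((1 - s) powr h * (1 + \<tau>)\<^sup>2) * PN" by (simp add: PN_def N_def)
        also have "\<dots> \<le> C * (1 - F) * PN"
          using contr C0 PN0 by (intro mult_right_mono mult_left_mono) auto
        finally show ?thesis by (simp add: algebra_simps)
      qed
      have "(\<Sum>q\<in>X. \<Prod>j\<in>J. real (card (hits S (I j) {q})) powr p)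
          = (\<Sum>q\<in>X \<inter> V. \<Prod>i\<in>J. real (card (hits S (I i) {q})) powr p)
          + (\<Sum>q\<in>X - V. \<Prod>i\<in>J. real (card (hits S (I i) {q})) powr p)"
        using less.prems(1) by (rule sum.Int_Diff)
      also have "\<dots> \<le> (C - C * F) * PN + C * F * PN" using near far by (rule add_mono)
      finally show ?thesis by (simp add: PN_def N_def algebra_simps)
    qed
  qed
  show ?thesis
    by (intro exI[of _ \<theta>] exI[of _ C] conjI \<theta>(1) C0 allI impI main) (assumption | blast)+
qed

section \<open>Discretising tubes\<close>

lemma orthonormal_frame_expansion:
  fixes u :: "'d::finite \<Rightarrow> real ^ 'd"
  assumes "orthonormal_frame u"
  shows "y = (\<Sum>i\<in>UNIV. (y \<bullet> u i) *\<^sub>R u i)"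
proof -
  have uu: "u i \<bullet> u j = (if i = j then 1 else 0)" for i j
    using assms by (simp add: orthonormal_frame_def)
  have inj: "inj u"
  proof (rule injI)
    fix i j assume "u i = u j"
    then have "u i \<bullet> u j = 1" using uu[of i i] by simp
    then show "i = j" using uu[of i j] by (simp split: if_splits)
  qed
  have "independent (range u)"
  proof (rule pairwise_orthogonal_independent)
    show "pairwise orthogonal (range u)" by (auto simp: pairwise_def orthogonal_def uu split: if_splits)
    show "0 \<notin> range u"
    proof
      assume "0 \<in> range u"
      then obtain i where "u i = 0" by auto
      then show False using uu[of i i] by simp
    qed
  qed
  moreover have "dim (UNIV :: (real ^ 'd) set) \<le> card (range u)"
    using inj by (simp add: card_image)
  ultimately have span: "UNIV \<subseteq> span (range u)"
    by (intro card_ge_dim_independent) simp_all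
  define e where "e = y - (\<Sum>i\<in>UNIV. (y \<bullet> u i) *\<^sub>R u i)"
  have "e \<bullet> u k = 0" for k
    unfolding e_def by (simp add: inner_diff_left inner_sum_left uu if_distrib[of "\<lambda>t. _ * t"] cong: if_cong)
  then have "orthogonal e v" if "v \<in> range u" for v
    using that by (auto simp: orthogonal_def)
  then have "orthogonal e e" using span by (intro orthogonal_to_span[of e "range u" e]) auto
  then show ?thesis by (simp add: e_def orthogonal_def)
qed

lemma closed_rectangular_box: "closed (rectangular_box c u l)"
  unfolding rectangular_box_def
  by (intro closed_Collect_all closed_Collect_le continuous_intros)

text \<open>Two points of a tube differ by at most \<open>1\<close> along the long side and by a multiple of \<open>\<delta>\<close> across it.\<close>
lemma tube_difference:
  fixes \<omega> :: "real ^ 'd::finite"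
  assumes "tube_with_direction \<delta> \<omega> T" "0 \<le> \<delta>" "x \<in> T" "x' \<in> T"
  obtains s z where "x - x' = s *\<^sub>R \<omega> + z" "\<bar>s\<bar> \<le> 1" "norm z \<le> real CARD('d) * \<delta>" "norm \<omega> = 1"
proof -
  obtain c u k where u: "orthonormal_frame u" "u k = \<omega>"
    "T = rectangular_box c u (\<lambda>i. if i = k then 1 else \<delta>)"
    using assms(1) unfolding tube_with_direction_def by blast
  have nu: "norm (u i) = 1" for i
    using u(1) by (simp add: orthonormal_frame_def norm_eq_1)
  define a where "a i = (x - x') \<bullet> u i" for i
  have a: "\<bar>a i\<bar> \<le> (if i = k then 1 else \<delta>)" for i
  proof -
    have "\<bar>(x - c) \<bullet> u i\<bar> \<le> (if i = k then 1 else \<delta>) / 2" "\<bar>(x' - c) \<bullet> u i\<bar> \<le> (if i = k then 1 else \<delta>) / 2"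
      using assms(3,4) u(3) by (auto simp only: rectangular_box_def mem_Collect_eq)
    moreover have "a i = (x - c) \<bullet> u i - (x' - c) \<bullet> u i" by (simp add: a_def inner_diff_left)
    ultimately show ?thesis by linarith
  qed
  define z where "z = (\<Sum>i\<in>UNIV - {k}. a i *\<^sub>R u i)"
  have "x - x' = a k *\<^sub>R \<omega> + z"
    using orthonormal_frame_expansion[OF u(1), of "x - x'"] u(2)
    by (simp add: a_def z_def sum.remove[of UNIV k])
  moreover have "\<bar>a k\<bar> \<le> 1" using a[of k] by simp
  moreover have "norm z \<le> real CARD('d) * \<delta>"
  proof -
    have "norm z \<le> (\<Sum>i\<in>UNIV - {k}. \<delta>)"
      unfolding z_def
    proof (rule sum_norm_le)
      show "norm (a i *\<^sub>R u i) \<le> \<delta>" if "i \<in> UNIV - {k}" for i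
        using a[of i] nu[of i] that by simp
    qed
    also have "\<dots> \<le> (\<Sum>i\<in>(UNIV::'d set). \<delta>)" using assms(2) by (intro sum_mono2) auto
    finally show ?thesis by simp
  qed
  moreover have "norm \<omega> = 1" using nu[of k] u(2) by simp
  ultimately show ?thesis using that by blast
qed

text \<open>The map that sends the standard basis to \<open>v\<close> differs from the identity by an operator of norm
  at most \<open>1/2\<close>, so it is invertible with norms of both the map and its inverse bounded by \<open>2\<close>; the
  inverse is \<open>g\<close>. The point is that these bounds are uniform in \<open>v\<close>.\<close>
lemma near_standard_basis_coordinates:
  fixes v :: "'d::finite \<Rightarrow> real ^ 'd"
  assumes v: "\<And>i. norm (v i - axis i 1) \<le> 1 / (2 * real CARD('d))"
  obtains g :: "real ^ 'd \<Rightarrow> real ^ 'd"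
  where "linear g" "\<And>i. g (v i) = axis i 1" "\<And>x. norm (g x) \<le> 2 * norm x" "\<And>x. norm x \<le> 2 * norm (g x)"
proof -
  define L where "L y = (\<Sum>i\<in>UNIV. (y $ i) *\<^sub>R v i)" for y :: "real ^ 'd"
  have lin: "linear L"
    unfolding L_def by (intro linearI) (simp_all add: scaleR_left_distrib sum.distrib scaleR_sum_right)
  have Lv: "L (axis i 1) = v i" for i
    by (simp add: L_def axis_def if_distrib[of "\<lambda>a. a *\<^sub>R _"] cong: if_cong)
  have close: "norm (L y - y) \<le> norm y / 2" for y
  proof -
    have "y = (\<Sum>i\<in>UNIV. (y $ i) *\<^sub>R axis i 1)"
      using basis_expansion[of y] by (simp add: scalar_mult_eq_scaleR)
    then have "L y - y = (\<Sum>i\<in>UNIV. (y $ i) *\<^sub>R (v i - axis i 1))"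
      unfolding L_def by (simp add: scaleR_diff_right sum_subtractf)
    also have "norm \<dots> \<le> (\<Sum>i\<in>(UNIV::'d set). norm y * (1 / (2 * real CARD('d))))"
      using v by (intro sum_norm_le) (simp only: norm_scaleR, intro mult_mono, auto simp: component_le_norm_cart)
    also have "\<dots> = norm y / 2" by simp
    finally show ?thesis .
  qed
  have lower: "norm y \<le> 2 * norm (L y)" for y
    using close[of y] norm_triangle_ineq2[of y "L y"] by (simp add: norm_minus_commute)
  have upper: "norm (L y) \<le> 2 * norm y" for y
    using close[of y] norm_triangle_ineq2[of "L y" y] norm_ge_zero[of y] by linarith
  have "inj L" using lin
  proof (rule linear_injective_0[THEN iffD2], intro allI impI)
    fix y assume "L y = 0"
    then show "y = 0" using lower[of y] by simp
  qed
  then obtain g where g: "linear g" "\<And>x. g (L x) = x" "\<And>x. L (g x) = x"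
    using linear_injective_isomorphism[OF lin] by auto
  show ?thesis
  proof
    show "linear g" by fact
    show "g (v i) = axis i 1" for i using g(2)[of "axis i 1"] Lv by simp
    show "norm (g x) \<le> 2 * norm x" for x using lower[of "g x"] g(3) by simp
    show "norm x \<le> 2 * norm (g x)" for x using upper[of "g x"] g(3) by simp
  qed
qed

definition cell :: "(real ^ 'd \<Rightarrow> real ^ 'd) \<Rightarrow> real \<Rightarrow> real ^ 'd \<Rightarrow> 'd \<Rightarrow> int" where
  "cell g \<delta> x = (\<lambda>i. \<lfloor>g x $ i / \<delta>\<rfloor>)"

lemma floor_diff_bounds:
  fixes a b :: real
  shows "\<bar>real_of_int (\<lfloor>a\<rfloor> - \<lfloor>b\<rfloor>)\<bar> \<le> \<bar>a - b\<bar> + 1" "\<bar>a - b\<bar> \<le> \<bar>real_of_int (\<lfloor>a\<rfloor> - \<lfloor>b\<rfloor>)\<bar> + 1"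
  unfolding of_int_diff
  using floor_correct[of a] floor_correct[of b] by linarith+

text \<open>In the coordinates \<open>g\<close> the direction of the tube is within \<open>2\<epsilon>\<close> of the \<open>j\<close>-th basis vector, and the
  cross section has size of order \<open>\<delta>\<close>. Rescaling by \<open>\<delta>\<close> and rounding leave the slope and turn all
  other terms into an additive constant.\<close>
lemma thin_cell_tube:
  fixes g :: "real ^ 'd::finite \<Rightarrow> real ^ 'd"
  assumes g: "linear g" "g v = axis j 1" "\<And>x. norm (g x) \<le> 2 * norm x"
    and tube: "tube_with_direction \<delta> \<omega> T" and \<delta>: "0 < \<delta>"
    and \<omega>: "norm (\<omega> - v) \<le> \<epsilon>" "\<epsilon> \<le> 1/4"
  shows "thin (4 * \<epsilon>) (4 * real CARD('d) + 2) j (cell g \<delta> ` T)"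
  unfolding thin_def
proof (intro ballI allI impI)
  fix q q' i assume q: "q \<in> cell g \<delta> ` T" "q' \<in> cell g \<delta> ` T" and ij: "i \<noteq> j"
  then obtain x x' where x: "x \<in> T" "x' \<in> T" "q = cell g \<delta> x" "q' = cell g \<delta> x'" by blast
  let ?d = "real CARD('d)"
  obtain s z where sz: "x - x' = s *\<^sub>R \<omega> + z" "\<bar>s\<bar> \<le> 1" "norm z \<le> ?d * \<delta>"
    using tube_difference[OF tube _ x(1,2)] \<delta> by (metis less_imp_le)
  have \<epsilon>0: "0 \<le> \<epsilon>" using \<omega> norm_ge_zero order_trans by blast
  define y where "y = g (\<omega> - v)"
  define t where "t = g z"
  have y: "\<bar>y $ k\<bar> \<le> 2 * \<epsilon>" for k
    using component_le_norm_cart[of y k] g(3)[of "\<omega> - v"] \<omega>(1) by (simp add: y_def)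
  have t: "\<bar>t $ k\<bar> \<le> 2 * ?d * \<delta>" for k
    using component_le_norm_cart[of t k] g(3)[of z] sz(3) by (simp add: t_def)
  have "x - x' = s *\<^sub>R v + s *\<^sub>R (\<omega> - v) + z" using sz(1) by (simp add: algebra_simps)
  then have "g (x - x') = s *\<^sub>R axis j 1 + s *\<^sub>R y + t"
    using g(1,2) by (simp add: linear_add linear_scale y_def t_def)
  then have diff: "g x $ k - g x' $ k = s * (if k = j then 1 else 0) + s * y $ k + t $ k" for k
    using g(1) by (simp add: linear_diff vec_eq_iff axis_def if_distrib)
  have sy: "\<bar>s * y $ k\<bar> \<le> \<bar>s\<bar> * (2 * \<epsilon>)" for k
    unfolding abs_mult using y by (intro mult_left_mono) auto
  define A where "A k = \<bar>g x $ k - g x' $ k\<bar>" for k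
  have "\<bar>s\<bar> * (2 * \<epsilon>) \<le> \<bar>s\<bar> * (1/2)" using \<omega>(2) by (intro mult_left_mono) auto
  then have s: "\<bar>s\<bar> \<le> 2 * A j + 4 * ?d * \<delta>"
  proof -
    have "g x $ j - g x' $ j = s + s * y $ j + t $ j" using diff[of j] by simp
    moreover have "\<bar>s * y $ j\<bar> \<le> \<bar>s\<bar> / 2"
      using sy[of j] \<open>\<bar>s\<bar> * (2 * \<epsilon>) \<le> \<bar>s\<bar> * (1/2)\<close> by simp
    moreover have "\<bar>a\<bar> \<le> 2 * \<bar>a + b + c\<bar> + 2 * e" if "\<bar>b\<bar> \<le> \<bar>a\<bar> / 2" "\<bar>c\<bar> \<le> e" for a b c e :: real
      using that by (smt (verit) field_sum_of_halves)
    ultimately have "\<bar>s\<bar> \<le> 2 * \<bar>g x $ j - g x' $ j\<bar> + 2 * (2 * ?d * \<delta>)" using t[of j] by metis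
    then show ?thesis by (simp add: A_def)
  qed
  have "A i \<le> \<bar>s\<bar> * (2 * \<epsilon>) + 2 * ?d * \<delta>"
    using diff[of i] sy[of i] t[of i] ij by (simp add: A_def)
  also have "\<bar>s\<bar> * (2 * \<epsilon>) \<le> (2 * A j + 4 * ?d * \<delta>) * (2 * \<epsilon>)"
    using s \<epsilon>0 by (intro mult_right_mono) auto
  also have "\<dots> = 4 * \<epsilon> * A j + (4 * \<epsilon>) * (2 * ?d * \<delta>)" by (simp add: algebra_simps)
  also have "(4 * \<epsilon>) * (2 * ?d * \<delta>) \<le> 1 * (2 * ?d * \<delta>)" using \<omega>(2) \<delta> by (intro mult_right_mono) auto
  finally have "A i \<le> 4 * \<epsilon> * A j + 4 * ?d * \<delta>" by (simp add: algebra_simps)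
  then have "A i / \<delta> \<le> (4 * \<epsilon> * A j + 4 * ?d * \<delta>) / \<delta>" using \<delta> by (intro divide_right_mono) auto
  then have Ai: "A i / \<delta> \<le> 4 * \<epsilon> * (A j / \<delta>) + 4 * ?d" using \<delta> by (simp add: add_divide_distrib)
  have A\<delta>: "\<bar>g x $ k / \<delta> - g x' $ k / \<delta>\<bar> = A k / \<delta>" for k
    using \<delta> by (simp add: A_def diff_divide_distrib[symmetric] abs_divide)
  have "A j / \<delta> \<le> \<bar>real_of_int (q j - q' j)\<bar> + 1"
    using floor_diff_bounds(2)[of "g x $ j / \<delta>" "g x' $ j / \<delta>"] unfolding A\<delta> x cell_def .
  then have "4 * \<epsilon> * (A j / \<delta>) \<le> 4 * \<epsilon> * (\<bar>real_of_int (q j - q' j)\<bar> + 1)"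
    using \<epsilon>0 by (intro mult_left_mono) auto
  moreover have "\<bar>real_of_int (q i - q' i)\<bar> \<le> A i / \<delta> + 1"
    using floor_diff_bounds(1)[of "g x $ i / \<delta>" "g x' $ i / \<delta>"] unfolding A\<delta> x cell_def .
  ultimately show "\<bar>real_of_int (q i - q' i)\<bar> \<le> 4 * \<epsilon> * \<bar>real_of_int (q j - q' j)\<bar> + (4 * ?d + 2)"
    using Ai \<omega>(2) by (simp add: algebra_simps)
qed

lemma finite_cell_tube:
  fixes g :: "real ^ 'd::finite \<Rightarrow> real ^ 'd"
  assumes g: "linear g" "\<And>x. norm (g x) \<le> 2 * norm x"
    and tube: "tube_with_direction \<delta> \<omega> T" and \<delta>: "0 < \<delta>"
  shows "finite (cell g \<delta> ` T)"
proof (cases "T = {}")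
  case False
  then obtain x0 where x0: "x0 \<in> T" by blast
  define B where "B = 2 * (1 + real CARD('d) * \<delta>)"
  have "cell g \<delta> ` T \<subseteq> PiE UNIV (\<lambda>i. {\<lfloor>(g x0 $ i - B) / \<delta>\<rfloor>..\<lfloor>(g x0 $ i + B) / \<delta>\<rfloor>})"
  proof (clarsimp simp: PiE_iff cell_def)
    fix x i assume x: "x \<in> T"
    obtain s z where sz: "x - x0 = s *\<^sub>R \<omega> + z" "\<bar>s\<bar> \<le> 1" "norm z \<le> real CARD('d) * \<delta>" "norm \<omega> = 1"
      using tube_difference[OF tube _ x x0] \<delta> by (metis less_imp_le)
    have "norm (x - x0) \<le> 1 + real CARD('d) * \<delta>"
      unfolding sz(1) using sz by (intro norm_triangle_le add_mono) auto
    then have "2 * norm (x - x0) \<le> B" unfolding B_def by (intro mult_left_mono) auto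
    then have "norm (g (x - x0)) \<le> B" using g(2)[of "x - x0"] by linarith
    then have "\<bar>g x $ i - g x0 $ i\<bar> \<le> B"
      using component_le_norm_cart[of "g (x - x0)" i] g(1) by (simp add: linear_diff)
    then show "\<lfloor>(g x0 $ i - B) / \<delta>\<rfloor> \<le> \<lfloor>g x $ i / \<delta>\<rfloor> \<and> \<lfloor>g x $ i / \<delta>\<rfloor> \<le> \<lfloor>(g x0 $ i + B) / \<delta>\<rfloor>"
      using \<delta> by (intro conjI floor_mono divide_right_mono) auto
  qed
  then show ?thesis by (rule finite_subset) (auto intro: finite_PiE)
qed simp

text \<open>An upper bound for the volume of a cell suffices, and a cube around one of its points gives one
  without computing a determinant.\<close>
lemma cell_in_cube:
  fixes g :: "real ^ 'd::finite \<Rightarrow> real ^ 'd"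
  assumes g: "linear g" "\<And>x. norm x \<le> 2 * norm (g x)" and \<delta>: "0 < \<delta>"
  shows "\<exists>B. B \<in> sets lborel \<and> emeasure lborel B = ennreal ((4 * real CARD('d) * \<delta>) ^ CARD('d)) \<and> {x. cell g \<delta> x = q} \<subseteq> B"
proof -
  let ?r = "2 * real CARD('d) * \<delta>"
  obtain x0 where x0: "{x. cell g \<delta> x = q} \<noteq> {} \<Longrightarrow> cell g \<delta> x0 = q" by blast
  define B where "B = cbox (\<chi> i. x0 $ i - ?r) (\<chi> i. x0 $ i + ?r)"
  have "emeasure lborel B = ennreal ((4 * real CARD('d) * \<delta>) ^ CARD('d))"
  proof -
    have "x0 \<in> B" using \<delta> by (simp add: B_def mem_box_cart)
    then have "measure lborel B = (4 * real CARD('d) * \<delta>) ^ CARD('d)"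
      unfolding B_def by (subst content_cbox_cart) (auto simp flip: power_mult_distrib simp: mult_ac)
    then show ?thesis
      unfolding B_def by (metis emeasure_eq_ennreal_measure emeasure_lborel_cbox_finite less_irrefl infinity_ennreal_def)
  qed
  moreover have "{x. cell g \<delta> x = q} \<subseteq> B"
  proof clarify
    fix x assume x: "q = cell g \<delta> x"
    then have same: "cell g \<delta> x0 = cell g \<delta> x" using x0 by auto
    have "\<bar>g (x - x0) $ i\<bar> \<le> \<delta>" for i
    proof -
      have "\<lfloor>g x0 $ i / \<delta>\<rfloor> = \<lfloor>g x $ i / \<delta>\<rfloor>" using fun_cong[OF same, of i] by (simp add: cell_def)
      then have "\<bar>g x $ i / \<delta> - g x0 $ i / \<delta>\<bar> \<le> 1"
        using floor_diff_bounds(2)[of "g x $ i / \<delta>" "g x0 $ i / \<delta>"] by simp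
      then have "\<bar>g x $ i - g x0 $ i\<bar> / \<delta> \<le> 1" using \<delta> by (simp add: diff_divide_distrib[symmetric] abs_divide)
      then show ?thesis using \<delta> g(1) by (simp add: linear_diff)
    qed
    then have "norm (g (x - x0)) \<le> (\<Sum>i\<in>(UNIV::'d set). \<delta>)"
      by (intro order_trans[OF norm_le_l1_cart] sum_mono)
    then have n: "norm (x - x0) \<le> ?r" using g(2)[of "x - x0"] by simp
    have "\<bar>x $ i - x0 $ i\<bar> \<le> ?r" for i using component_le_norm_cart[of "x - x0" i] n by simp
    then show "x \<in> B" unfolding B_def
      by (simp add: mem_box_cart abs_le_iff algebra_simps)
  qed
  moreover have "B \<in> sets lborel" by (simp add: B_def)
  ultimately show ?thesis by blast
qed

section \<open>From caps to the fixed neighbourhoods\<close>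

lemma sum_indicator_eq_card:
  "finite A \<Longrightarrow> (\<Sum>T\<in>A. indicator T x) = real (card {T\<in>A. x \<in> T})"
  by (simp add: indicator_def sum.If_cases Int_def)

text \<open>On a cell the product of the tube counts is at most the product of the numbers of discretised
  tubes through the lattice point of that cell, so the integral is at most a multiple of
  \<open>\<delta>\<^sup>d\<close> times the discrete sum. The radius \<open>\<epsilon>\<close> of the caps depends on \<open>p\<close>, but \<open>\<epsilon>\<close> and \<open>C\<close> do not
  depend on the centres \<open>v\<close> of the caps.\<close>
lemma tiny_caps_estimate:
  fixes J :: "'d::finite set" and p :: real
  assumes J: "2 \<le> card J" and p: "1 / (real (card J) - 1) < p"
  shows "\<exists>\<epsilon>>0. \<exists>C\<ge>0. \<forall>(v :: 'd \<Rightarrow> real ^ 'd) \<delta> (\<T> :: 'd \<Rightarrow> (real ^ 'd) set set).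
      (\<forall>i. norm (v i - axis i 1) \<le> 1 / (2 * real CARD('d))) \<longrightarrow> 0 < \<delta> \<longrightarrow>
      (\<forall>j\<in>J. finite (\<T> j)) \<longrightarrow>
      (\<forall>j\<in>J. \<forall>T\<in>\<T> j. \<exists>\<omega>. norm (\<omega> - v j) \<le> \<epsilon> \<and> tube_with_direction \<delta> \<omega> T) \<longrightarrow>
      (\<integral>\<^sup>+ x. ennreal ((\<Prod>j\<in>J. \<Sum>T\<in>\<T> j. indicator T x) powr p) \<partial>lborel)
        \<le> ennreal (C * \<delta> ^ CARD('d) * (\<Prod>j\<in>J. real (card (\<T> j)) powr p))"
proof -
  let ?d = "real CARD('d)"
  have "\<exists>\<theta>>0. \<exists>C\<ge>0. \<forall>(S :: (real ^ 'd) set \<Rightarrow> ('d \<Rightarrow> int) set) I X.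
      finite X \<longrightarrow> (\<forall>j\<in>J. finite (I j)) \<longrightarrow> (\<forall>j\<in>J. \<forall>T\<in>I j. S T \<noteq> {} \<and> thin \<theta> (4 * ?d + 2) j (S T)) \<longrightarrow>
      (\<Sum>q\<in>X. \<Prod>j\<in>J. real (card (hits S (I j) {q})) powr p) \<le> C * (\<Prod>j\<in>J. real (card (I j)) powr p)"
    by (rule discrete_multilinear_kakeya[OF J p]) simp
  then obtain \<theta> C where \<theta>: "0 < \<theta>" and C: "0 \<le> C" and kakeya:
    "\<forall>(S :: (real ^ 'd) set \<Rightarrow> ('d \<Rightarrow> int) set) I X.
      finite X \<longrightarrow> (\<forall>j\<in>J. finite (I j)) \<longrightarrow> (\<forall>j\<in>J. \<forall>T\<in>I j. S T \<noteq> {} \<and> thin \<theta> (4 * ?d + 2) j (S T)) \<longrightarrow>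
      (\<Sum>q\<in>X. \<Prod>j\<in>J. real (card (hits S (I j) {q})) powr p) \<le> C * (\<Prod>j\<in>J. real (card (I j)) powr p)"
    by (elim exE conjE)
  define \<epsilon> where "\<epsilon> = min (1/4) (\<theta> / 4)"
  have \<epsilon>: "0 < \<epsilon>" "\<epsilon> \<le> 1/4" "4 * \<epsilon> \<le> \<theta>" using \<theta> by (auto simp: \<epsilon>_def)
  have "0 \<le> 1 / (real (card J) - 1)" using J by simp
  then have p0: "0 < p" using p by linarith
  define C' where "C' = (4 * ?d) ^ CARD('d) * C"
  have est: "(\<integral>\<^sup>+ x. ennreal ((\<Prod>j\<in>J. \<Sum>T\<in>\<T> j. indicator T x) powr p) \<partial>lborel)
        \<le> ennreal (C' * \<delta> ^ CARD('d) * (\<Prod>j\<in>J. real (card (\<T> j)) powr p))"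
    if v: "\<And>i. norm (v i - axis i 1) \<le> 1 / (2 * ?d)" and \<delta>: "0 < \<delta>"
      and fin: "\<And>j. j \<in> J \<Longrightarrow> finite (\<T> j)"
      and tubes: "\<And>j T. j \<in> J \<Longrightarrow> T \<in> \<T> j \<Longrightarrow> \<exists>\<omega>. norm (\<omega> - v j) \<le> \<epsilon> \<and> tube_with_direction \<delta> \<omega> T"
    for v :: "'d \<Rightarrow> real ^ 'd" and \<delta> and \<T> :: "'d \<Rightarrow> (real ^ 'd) set set"
  proof -
    obtain g :: "real ^ 'd \<Rightarrow> real ^ 'd" where g: "linear g" "\<And>i. g (v i) = axis i 1"
      "\<And>x. norm (g x) \<le> 2 * norm x" "\<And>x. norm x \<le> 2 * norm (g x)"
      using near_standard_basis_coordinates[OF v] by blast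
    define S where "S T = cell g \<delta> ` T" for T
    define X where "X = (\<Union>j\<in>J. \<Union>T\<in>\<T> j. S T)"
    have finX: "finite X"
      unfolding X_def S_def
    proof (intro finite_UN_I fin)
      fix j T assume "j \<in> J" "T \<in> \<T> j"
      then obtain \<omega> where "tube_with_direction \<delta> \<omega> T" using tubes by blast
      then show "finite (cell g \<delta> ` T)" using finite_cell_tube g \<delta> by blast
    qed simp_all
    define H where "H q = (\<Prod>j\<in>J. real (card (hits S (\<T> j) {q})) powr p)" for q
    have H0: "0 \<le> H q" for q by (simp add: H_def prod_nonneg)
    have sumH: "(\<Sum>q\<in>X. H q) \<le> C * (\<Prod>j\<in>J. real (card (\<T> j)) powr p)"
      unfolding H_def
    proof (rule kakeya[rule_format, OF finX fin])
      fix j T assume jT: "j \<in> J" "T \<in> \<T> j"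
      then obtain \<omega> where \<omega>: "norm (\<omega> - v j) \<le> \<epsilon>" "tube_with_direction \<delta> \<omega> T" using tubes by blast
      have "thin (4 * \<epsilon>) (4 * ?d + 2) j (S T)"
        unfolding S_def by (rule thin_cell_tube[OF g(1,2,3) \<omega>(2) \<delta> \<omega>(1) \<epsilon>(2)])
      then have "thin \<theta> (4 * ?d + 2) j (S T)"
        using \<epsilon>(3) by (rule thin_mono)
      moreover have "T \<noteq> {}"
      proof -
        obtain c u k where "T = rectangular_box c u (\<lambda>i. if i = k then 1 else \<delta>)"
          using \<omega>(2) unfolding tube_with_direction_def by blast
        then have "c \<in> T" using \<delta> by (simp add: rectangular_box_def)
        then show ?thesis by blast
      qed
      ultimately show "S T \<noteq> {} \<and> thin \<theta> (4 * ?d + 2) j (S T)" by (simp add: S_def)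
    qed
    have "\<forall>q. \<exists>B. B \<in> sets lborel \<and> emeasure lborel B = ennreal ((4 * ?d * \<delta>) ^ CARD('d)) \<and> {x. cell g \<delta> x = q} \<subseteq> B"
      by (intro allI cell_in_cube g \<delta>)
    from choice[OF this] obtain B where B: "\<And>q. B q \<in> sets lborel"
      "\<And>q. emeasure lborel (B q) = ennreal ((4 * ?d * \<delta>) ^ CARD('d))" "\<And>q. {x. cell g \<delta> x = q} \<subseteq> B q"
      by blast
    have pt: "ennreal ((\<Prod>j\<in>J. \<Sum>T\<in>\<T> j. indicator T x) powr p) \<le> (\<Sum>q\<in>X. ennreal (H q) * indicator (B q) x)" for x
    proof -
      let ?q = "cell g \<delta> x"
      have le: "(\<Sum>T\<in>\<T> j. indicator T x) \<le> real (card (hits S (\<T> j) {?q}))" if "j \<in> J" for j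
        unfolding sum_indicator_eq_card[OF fin[OF that]] of_nat_le_iff
        using fin[OF that] by (intro card_mono) (auto simp: hits_def S_def)
      have "(\<Prod>j\<in>J. \<Sum>T\<in>\<T> j. indicator T x) powr p \<le> (\<Prod>j\<in>J. real (card (hits S (\<T> j) {?q}))) powr p"
        using p0 by (intro powr_mono2 prod_mono conjI le prod_nonneg sum_nonneg) auto
      also have "\<dots> = H ?q" unfolding H_def by (rule prod_powr_distrib)
      finally have F: "(\<Prod>j\<in>J. \<Sum>T\<in>\<T> j. indicator T x) powr p \<le> H ?q" .
      show ?thesis
      proof (cases "?q \<in> X")
        case True
        have "ennreal ((\<Prod>j\<in>J. \<Sum>T\<in>\<T> j. indicator T x) powr p) \<le> ennreal (H ?q) * indicator (B ?q) x"
          using F B(3)[of ?q] by (auto simp: indicator_def intro: ennreal_leI)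
        also have "\<dots> \<le> (\<Sum>q\<in>X. ennreal (H q) * indicator (B q) x)"
          using True finX by (intro member_le_sum[where f = "\<lambda>q. ennreal (H q) * indicator (B q) x"]) auto
        finally show ?thesis .
      next
        case False
        obtain j where j: "j \<in> J" using J by fastforce
        then have "hits S (\<T> j) {?q} = {}" using False by (auto simp: hits_def X_def)
        then have "H ?q = 0" unfolding H_def using j by (intro prod_zero) (auto intro!: bexI[of _ j])
        then have "(\<Prod>j\<in>J. \<Sum>T\<in>\<T> j. indicator T x) powr p = 0"
          using F by (intro order_antisym) auto
        then show ?thesis by (simp only: ennreal_0 zero_le)
      qed
    qed
    have "(\<integral>\<^sup>+ x. ennreal ((\<Prod>j\<in>J. \<Sum>T\<in>\<T> j. indicator T x) powr p) \<partial>lborel)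
        \<le> (\<integral>\<^sup>+ x. (\<Sum>q\<in>X. ennreal (H q) * indicator (B q) x) \<partial>lborel)"
      by (intro nn_integral_mono pt)
    also have "\<dots> = (\<Sum>q\<in>X. ennreal (H q) * emeasure lborel (B q))"
      using B(1) by (subst nn_integral_sum) (auto simp: nn_integral_cmult_indicator)
    also have "\<dots> = ennreal ((4 * ?d * \<delta>) ^ CARD('d) * (\<Sum>q\<in>X. H q))"
      unfolding B(2) using H0 \<delta>
      by (simp only: sum_distrib_right[symmetric] sum_ennreal)
        (subst mult.commute, subst ennreal_mult, auto intro: sum_nonneg)
    also have "\<dots> \<le> ennreal ((4 * ?d * \<delta>) ^ CARD('d) * (C * (\<Prod>j\<in>J. real (card (\<T> j)) powr p)))"
      using sumH \<delta> by (intro ennreal_leI mult_left_mono) auto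
    also have "\<dots> = ennreal (C' * \<delta> ^ CARD('d) * (\<Prod>j\<in>J. real (card (\<T> j)) powr p))"
      by (simp add: C'_def power_mult_distrib mult_ac)
    finally show ?thesis .
  qed
  have C'0: "0 \<le> C'" using C by (simp add: C'_def)
  show ?thesis
    by (intro exI[of _ \<epsilon>] exI[of _ C'] conjI \<epsilon>(1) C'0 allI impI est) (assumption | blast)+
qed

lemma sum_powr_le:
  fixes t :: "'a \<Rightarrow> real"
  assumes "finite A" "\<And>a. a \<in> A \<Longrightarrow> 0 \<le> t a" "0 \<le> p"
  shows "(\<Sum>a\<in>A. t a) powr p \<le> real (card A) powr p * (\<Sum>a\<in>A. t a powr p)"
proof (cases "A = {}")
  case False
  define M where "M = Max (t ` A)"
  have "M \<in> t ` A" unfolding M_def using assms False by (intro Max_in) auto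
  then obtain b where b: "b \<in> A" "M = t b" by blast
  have "t a \<le> M" if "a \<in> A" for a unfolding M_def using assms that by (intro Max_ge) auto
  then have "sum t A \<le> real (card A) * M" using sum_bounded_above[of A t M] by simp
  then have "(\<Sum>a\<in>A. t a) powr p \<le> (real (card A) * M) powr p"
    using assms by (intro powr_mono2 sum_nonneg) auto
  also have "\<dots> = real (card A) powr p * t b powr p" using b assms by (simp add: powr_mult)
  also have "\<dots> \<le> real (card A) powr p * (\<Sum>a\<in>A. t a powr p)"
    using b assms by (intro mult_left_mono member_le_sum[where f = "\<lambda>a. t a powr p"]) auto
  finally show ?thesis .
qed simp

lemma tube_measurable:
  assumes "tube_with_direction \<delta> \<omega> T" shows "T \<in> sets borel"
  using assms closed_rectangular_box unfolding tube_with_direction_def by (metis borel_closed)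

text \<open>A finite \<open>\<epsilon>\<close>-net \<open>Z\<close> of the ball of radius \<open>\<kappa> = 1 / (2 d)\<close> serves all directions at
  once: every tube is assigned to a cap with centre \<open>axis j 1 + z\<close>, \<open>z \<in> Z\<close>. Expanding the product of sums
  over the caps leaves a number of terms that depends only on \<open>p\<close>, \<open>card J\<close> and \<open>d\<close>, and each of them is
  bounded by \<open>tiny_caps_estimate\<close>.\<close>
lemma multilinear_kakeya_powr:
  fixes J :: "'d::finite set" and p :: real
  assumes J: "2 \<le> card J" and p: "1 / (real (card J) - 1) < p"
  shows "\<exists>C\<ge>0. \<forall>\<delta> (\<T> :: 'd \<Rightarrow> (real ^ 'd) set set). 0 < \<delta> \<longrightarrow> (\<forall>j\<in>J. finite (\<T> j)) \<longrightarrow>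
      (\<forall>j\<in>J. \<forall>T\<in>\<T> j. \<exists>\<omega>. norm (\<omega> - axis j 1) \<le> 1 / (2 * real CARD('d)) \<and> tube_with_direction \<delta> \<omega> T) \<longrightarrow>
      (\<integral>\<^sup>+ x. ennreal ((\<Prod>j\<in>J. \<Sum>T\<in>\<T> j. indicator T x) powr p) \<partial>lborel)
        \<le> ennreal (C * \<delta> ^ CARD('d) * (\<Prod>j\<in>J. real (card (\<T> j)) powr p))"
proof -
  let ?\<kappa> = "1 / (2 * real CARD('d))"
  obtain \<epsilon> C where \<epsilon>: "0 < \<epsilon>" and C: "0 \<le> C" and caps:
    "\<forall>(v :: 'd \<Rightarrow> real ^ 'd) \<delta> (\<T> :: 'd \<Rightarrow> (real ^ 'd) set set).
      (\<forall>i. norm (v i - axis i 1) \<le> ?\<kappa>) \<longrightarrow> 0 < \<delta> \<longrightarrow>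
      (\<forall>j\<in>J. finite (\<T> j)) \<longrightarrow>
      (\<forall>j\<in>J. \<forall>T\<in>\<T> j. \<exists>\<omega>. norm (\<omega> - v j) \<le> \<epsilon> \<and> tube_with_direction \<delta> \<omega> T) \<longrightarrow>
      (\<integral>\<^sup>+ x. ennreal ((\<Prod>j\<in>J. \<Sum>T\<in>\<T> j. indicator T x) powr p) \<partial>lborel)
        \<le> ennreal (C * \<delta> ^ CARD('d) * (\<Prod>j\<in>J. real (card (\<T> j)) powr p))"
    using tiny_caps_estimate[OF J p] by (elim exE conjE)
  have "0 \<le> 1 / (real (card J) - 1)" using J by simp
  then have p0: "0 < p" using p by linarith
  obtain Z :: "(real ^ 'd) set" where Z: "finite Z" "Z \<subseteq> cball 0 ?\<kappa>" "cball 0 ?\<kappa> \<subseteq> (\<Union>z\<in>Z. ball z \<epsilon>)"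
  proof (rule compactE_image[OF compact_cball[of "0 :: real ^ 'd" ?\<kappa>], of "cball 0 ?\<kappa>" "\<lambda>z. ball z \<epsilon>"])
    show "cball 0 ?\<kappa> \<subseteq> (\<Union>z\<in>cball (0 :: real ^ 'd) ?\<kappa>. ball z \<epsilon>)" using \<epsilon> by force
  qed (auto intro: that)
  define A where "A = PiE J (\<lambda>_. Z)"
  have finA: "finite A" unfolding A_def using Z by (intro finite_PiE) auto
  define M where "M = real (card A) powr p * (real (card A) * C)"
  have est: "(\<integral>\<^sup>+ x. ennreal ((\<Prod>j\<in>J. \<Sum>T\<in>\<T> j. indicator T x) powr p) \<partial>lborel)
        \<le> ennreal (M * \<delta> ^ CARD('d) * (\<Prod>j\<in>J. real (card (\<T> j)) powr p))"
    if \<delta>: "0 < \<delta>" and fin: "\<And>j. j \<in> J \<Longrightarrow> finite (\<T> j)" and tubes: "\<And>j T. j \<in> J \<Longrightarrow> T \<in> \<T> j \<Longrightarrow>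
        \<exists>\<omega>. norm (\<omega> - axis j 1) \<le> ?\<kappa> \<and> tube_with_direction \<delta> \<omega> T"
    for \<delta> and \<T> :: "'d \<Rightarrow> (real ^ 'd) set set"
  proof -
    have "\<exists>z\<in>Z. \<exists>\<omega>. norm (\<omega> - (axis j 1 + z)) \<le> \<epsilon> \<and> tube_with_direction \<delta> \<omega> T"
      if jT: "j \<in> J" "T \<in> \<T> j" for j T
    proof -
      obtain \<omega> where \<omega>: "norm (\<omega> - axis j 1) \<le> ?\<kappa>" "tube_with_direction \<delta> \<omega> T" using tubes[OF jT] by blast
      then have "\<omega> - axis j 1 \<in> cball 0 ?\<kappa>" by simp
      then obtain z where z: "z \<in> Z" "\<omega> - axis j 1 \<in> ball z \<epsilon>" using Z(3) by blast
      have "norm (\<omega> - (axis j 1 + z)) \<le> \<epsilon>"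
      proof -
        have "\<omega> - (axis j 1 + z) = - (z - (\<omega> - axis j 1))" by simp
        then show ?thesis using z(2) by (simp only: norm_minus_cancel mem_ball dist_norm less_imp_le)
      qed
      then show ?thesis using z(1) \<omega>(2) by blast
    qed
    then obtain \<zeta> where \<zeta>: "\<And>j T. j \<in> J \<Longrightarrow> T \<in> \<T> j \<Longrightarrow> \<zeta> j T \<in> Z"
      "\<And>j T. j \<in> J \<Longrightarrow> T \<in> \<T> j \<Longrightarrow> \<exists>\<omega>. norm (\<omega> - (axis j 1 + \<zeta> j T)) \<le> \<epsilon> \<and> tube_with_direction \<delta> \<omega> T"
      by metis
    define \<U> where "\<U> j z = {T \<in> \<T> j. \<zeta> j T = z}" for j z
    have finU: "finite (\<U> j z)" if "j \<in> J" for j z using fin[OF that] by (simp add: \<U>_def)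
    define F where "F a x = (\<Prod>j\<in>J. \<Sum>T\<in>\<U> j (a j). indicator T x :: real)" for a x
    have split: "(\<Prod>j\<in>J. \<Sum>T\<in>\<T> j. indicator T x) = (\<Sum>a\<in>A. F a x)" for x
    proof -
      have "(\<Sum>T\<in>\<T> j. indicator T x) = (\<Sum>z\<in>Z. \<Sum>T\<in>\<U> j z. indicator T x :: real)" if "j \<in> J" for j
        unfolding \<U>_def using fin[OF that] Z(1) \<zeta>(1)[OF that] by (intro sum.group[symmetric]) auto
      then show ?thesis
        unfolding F_def A_def using Z(1) by (simp add: prod_sum_PiE)
    qed
    have pieces: "(\<integral>\<^sup>+ x. ennreal (F a x powr p) \<partial>lborel)
        \<le> ennreal (C * \<delta> ^ CARD('d) * (\<Prod>j\<in>J. real (card (\<T> j)) powr p))" if a: "a \<in> A" for a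
    proof -
      define v where "v i = (if i \<in> J then axis i 1 + a i else axis i 1)" for i
      have v: "norm (v i - axis i 1) \<le> ?\<kappa>" for i
      proof (cases "i \<in> J")
        case True
        then have "a i \<in> cball 0 ?\<kappa>" using a Z(2) by (auto simp: A_def PiE_iff)
        then show ?thesis using True by (simp add: v_def)
      qed (simp add: v_def)
      have "(\<integral>\<^sup>+ x. ennreal (F a x powr p) \<partial>lborel)
          \<le> ennreal (C * \<delta> ^ CARD('d) * (\<Prod>j\<in>J. real (card (\<U> j (a j))) powr p))"
        unfolding F_def
      proof (rule caps[rule_format, OF v \<delta>])
        show "\<exists>\<omega>. norm (\<omega> - v j) \<le> \<epsilon> \<and> tube_with_direction \<delta> \<omega> T" if "j \<in> J" "T \<in> \<U> j (a j)" for j T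
          using that \<zeta>(2)[of j T] by (auto simp: v_def \<U>_def)
      qed (rule finU)
      also have "\<dots> \<le> ennreal (C * \<delta> ^ CARD('d) * (\<Prod>j\<in>J. real (card (\<T> j)) powr p))"
        using C \<delta> p0 fin
        by (intro ennreal_leI mult_left_mono prod_mono conjI powr_mono2) (auto simp: \<U>_def intro: card_mono)
      finally show ?thesis .
    qed
    have meas: "(\<lambda>x. ennreal (F a x powr p)) \<in> borel_measurable lborel" for a
    proof -
      have "T \<in> sets borel" if "j \<in> J" "T \<in> \<U> j (a j)" for j T
        using that \<zeta>(2) tube_measurable unfolding \<U>_def by blast
      then show ?thesis unfolding F_def by measurable
    qed
    have F0: "0 \<le> F a x" for a x by (auto simp: F_def intro!: prod_nonneg sum_nonneg)
    have "(\<integral>\<^sup>+ x. ennreal ((\<Prod>j\<in>J. \<Sum>T\<in>\<T> j. indicator T x) powr p) \<partial>lborel)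
        \<le> (\<integral>\<^sup>+ x. ennreal (real (card A) powr p) * (\<Sum>a\<in>A. ennreal (F a x powr p)) \<partial>lborel)"
    proof (rule nn_integral_mono)
      fix x
      have "ennreal ((\<Sum>a\<in>A. F a x) powr p) \<le> ennreal (real (card A) powr p * (\<Sum>a\<in>A. F a x powr p))"
        using F0 p0 finA by (intro ennreal_leI sum_powr_le) auto
      also have "\<dots> = ennreal (real (card A) powr p) * (\<Sum>a\<in>A. ennreal (F a x powr p))"
        by (simp add: ennreal_mult sum_nonneg sum_ennreal)
      finally show "ennreal ((\<Prod>j\<in>J. \<Sum>T\<in>\<T> j. indicator T x) powr p)
          \<le> ennreal (real (card A) powr p) * (\<Sum>a\<in>A. ennreal (F a x powr p))" unfolding split .
    qed
    also have "\<dots> = ennreal (real (card A) powr p) * (\<Sum>a\<in>A. \<integral>\<^sup>+ x. ennreal (F a x powr p) \<partial>lborel)"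
      by (subst nn_integral_cmult, rule borel_measurable_sum[OF meas], subst nn_integral_sum, rule meas, rule refl)
    also have "\<dots> \<le> ennreal (real (card A) powr p) *
        (\<Sum>a\<in>A. ennreal (C * \<delta> ^ CARD('d) * (\<Prod>j\<in>J. real (card (\<T> j)) powr p)))"
      by (intro mult_left_mono sum_mono pieces) auto
    also have "\<dots> = ennreal (M * \<delta> ^ CARD('d) * (\<Prod>j\<in>J. real (card (\<T> j)) powr p))"
    proof -
      have nn: "0 \<le> C * \<delta> ^ CARD('d) * (\<Prod>j\<in>J. real (card (\<T> j)) powr p)"
        using C \<delta> by (intro mult_nonneg_nonneg prod_nonneg) auto
      have "(\<Sum>a\<in>A. ennreal (C * \<delta> ^ CARD('d) * (\<Prod>j\<in>J. real (card (\<T> j)) powr p)))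
          = ennreal (real (card A) * (C * \<delta> ^ CARD('d) * (\<Prod>j\<in>J. real (card (\<T> j)) powr p)))"
        using nn by (subst sum_ennreal) auto
      then show ?thesis using nn
        by (simp only: M_def mult.assoc) (subst ennreal_mult[symmetric], auto)
    qed
    finally show ?thesis .
  qed
  have M0: "0 \<le> M" using C by (simp add: M_def)
  show ?thesis
    by (intro exI[of _ M] conjI M0 allI impI est) (assumption | blast)+
qed

section \<open>The multilinear Kakeya inequality\<close>

lemma Lnorm_infinity_le:
  fixes F :: "'a \<Rightarrow> real"
  assumes "F \<in> borel_measurable M" "\<And>x. \<bar>F x\<bar> \<le> K"
  shows "Lnorm M \<infinity> F \<le> ennreal K"
  unfolding Lnorm_def using assms by (auto intro!: esssup_I AE_I2 ennreal_leI)

lemma Lnorm_le: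
  assumes "0 < r" and F: "\<And>x. 0 \<le> F x" and "0 \<le> K"
    and int: "(\<integral>\<^sup>+ x. ennreal (F x powr r) \<partial>M) \<le> ennreal (K powr r)"
  shows "Lnorm M (ereal r) F \<le> ennreal K"
proof -
  define I where "I = (\<integral>\<^sup>+ x. ennreal (\<bar>F x\<bar> powr r) \<partial>M)"
  have I: "I \<le> ennreal (K powr r)" using int F by (simp add: I_def)
  then have fin: "I \<noteq> \<infinity>" by (auto simp: top_unique)
  have "enn2real I \<le> K powr r" by (rule enn2real_leI[OF _ I]) simp
  then have "enn2real I powr (1 / r) \<le> (K powr r) powr (1 / r)" using \<open>0 < r\<close> by (intro powr_mono2) auto
  also have "\<dots> = K" using \<open>0 < r\<close> \<open>0 \<le> K\<close> by (simp add: powr_powr)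
  finally have "ennreal (enn2real I powr (1 / r)) \<le> ennreal K" by (rule ennreal_leI)
  then show ?thesis using fin by (simp add: Lnorm_def Let_def I_def)
qed

theorem theorem5p1:
  fixes n :: nat and b :: "nat \<Rightarrow> 'd::finite"
  assumes "3 \<le> n" and "n \<le> CARD('d)"
    and "bij_betw b {1..CARD('d)} UNIV"
  shows "\<exists>N :: nat \<Rightarrow> (real ^ 'd) set.
    (\<forall>j\<in>{1..n}. openin (top_of_set (sphere 0 1)) (N j) \<and> axis (b j) 1 \<in> N j) \<and>
    (\<forall>q :: ereal. ereal (real n / (real n - 1)) < q \<and> q \<le> \<infinity> \<longrightarrow>
      (\<exists>C :: real. \<forall>\<delta> :: real. \<forall>\<T> :: nat \<Rightarrow> (real ^ 'd) set set.
        0 < \<delta> \<and> \<delta> \<le> 1 \<and>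
        (\<forall>j\<in>{1..n}. finite (\<T> j) \<and> (\<forall>T\<in>\<T> j. \<exists>\<omega>\<in>N j. tube_with_direction \<delta> \<omega> T)) \<longrightarrow>
        Lnorm lborel (q / ereal (real n)) (\<lambda>x. \<Prod>j=1..n. \<Sum>T\<in>\<T> j. indicator T x)
          \<le> ennreal (C * (\<Prod>j=1..n. \<delta> powr real_of_ereal (ereal (real CARD('d)) / q) * real (card (\<T> j))))))"
proof -
  let ?d = "real CARD('d)"
  let ?\<kappa> = "1 / (2 * ?d)"
  define J where "J = b ` {1..n}"
  have n: "3 \<le> n" by fact
  have inj: "inj_on b {1..n}"
    using assms(2,3) by (intro inj_on_subset[OF bij_betw_imp_inj_on[OF assms(3)]]) auto
  have cardJ: "card J = n" using inj by (simp add: J_def card_image)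
  have reindex: "(\<Prod>k\<in>J. h (inv_into {1..n} b k)) = (\<Prod>j=1..n. h j)" for h :: "nat \<Rightarrow> real"
    unfolding J_def using inj by (subst prod.reindex) (auto intro!: prod.cong)
  define N where "N j = sphere 0 1 \<inter> ball (axis (b j) (1 :: real)) ?\<kappa>" for j
  have open_N: "openin (top_of_set (sphere 0 1)) (N j) \<and> axis (b j) 1 \<in> N j" for j
    by (auto simp: N_def openin_open_Int dist_norm)
  have main: "\<exists>C :: real. \<forall>\<delta> :: real. \<forall>\<T> :: nat \<Rightarrow> (real ^ 'd) set set.
        0 < \<delta> \<and> \<delta> \<le> 1 \<and>
        (\<forall>j\<in>{1..n}. finite (\<T> j) \<and> (\<forall>T\<in>\<T> j. \<exists>\<omega>\<in>N j. tube_with_direction \<delta> \<omega> T)) \<longrightarrow>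
        Lnorm lborel (q / ereal (real n)) (\<lambda>x. \<Prod>j=1..n. \<Sum>T\<in>\<T> j. indicator T x)
          \<le> ennreal (C * (\<Prod>j=1..n. \<delta> powr real_of_ereal (ereal ?d / q) * real (card (\<T> j))))"
    if q: "ereal (real n / (real n - 1)) < q" for q
  proof (cases q)
    case PInf
    show ?thesis
    proof (intro exI[of _ 1] allI impI)
      fix \<delta> :: real and \<T> :: "nat \<Rightarrow> (real ^ 'd) set set"
      assume H: "0 < \<delta> \<and> \<delta> \<le> 1 \<and>
        (\<forall>j\<in>{1..n}. finite (\<T> j) \<and> (\<forall>T\<in>\<T> j. \<exists>\<omega>\<in>N j. tube_with_direction \<delta> \<omega> T))"
      have "\<bar>\<Prod>j=1..n. \<Sum>T\<in>\<T> j. indicator T x :: real\<bar> \<le> (\<Prod>j=1..n. real (card (\<T> j)))" for x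
      proof -
        have "(\<Prod>j=1..n. \<Sum>T\<in>\<T> j. indicator T x :: real) \<le> (\<Prod>j=1..n. real (card (\<T> j)))"
        proof (intro prod_mono conjI sum_nonneg)
          fix j assume "j \<in> {1..n}"
          have "(\<Sum>T\<in>\<T> j. indicator T x) \<le> (\<Sum>T\<in>\<T> j. 1 :: real)"
            by (intro sum_mono) (simp add: indicator_def)
          then show "(\<Sum>T\<in>\<T> j. indicator T x) \<le> real (card (\<T> j))" by simp
        qed simp
        moreover have "0 \<le> (\<Prod>j=1..n. \<Sum>T\<in>\<T> j. indicator T x :: real)"
          by (intro prod_nonneg sum_nonneg) auto
        ultimately show ?thesis by (simp only: abs_of_nonneg)
      qed
      then have "Lnorm lborel \<infinity> (\<lambda>x. \<Prod>j=1..n. \<Sum>T\<in>\<T> j. indicator T x) \<le> ennreal (\<Prod>j=1..n. real (card (\<T> j)))"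
      proof (rule Lnorm_infinity_le[rotated])
        have "T \<in> sets borel" if "j \<in> {1..n}" "T \<in> \<T> j" for j T
          using H that tube_measurable by blast
        then show "(\<lambda>x. \<Prod>j=1..n. \<Sum>T\<in>\<T> j. indicator T x :: real) \<in> borel_measurable lborel"
          by measurable
      qed
      then show "Lnorm lborel (q / ereal (real n)) (\<lambda>x. \<Prod>j=1..n. \<Sum>T\<in>\<T> j. indicator T x)
          \<le> ennreal (1 * (\<Prod>j=1..n. \<delta> powr real_of_ereal (ereal ?d / q) * real (card (\<T> j))))"
        using PInf n H by simp
    qed
  next
    case MInf
    then show ?thesis using q by simp
  next
    case (real r)
    have r: "real n / (real n - 1) < r" using q real by simp
    have "0 \<le> real n / (real n - 1)" using n by simp
    then have r0: "0 < r" using r by linarith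
    \<comment> \<open>The hypothesis on \<open>q\<close> says exactly that \<open>p > 1 / (n - 1)\<close>, and \<open>n * (d / q) * p = d\<close>.\<close>
    define p where "p = r / real n"
    have p0: "0 < p" using r0 n by (simp add: p_def)
    have pJ: "1 / (real (card J) - 1) < p"
      using r n by (simp add: cardJ p_def field_simps)
    have J2: "2 \<le> card J" using cardJ n by simp
    obtain C where C: "0 \<le> C" and est: "\<forall>\<delta> (\<T> :: 'd \<Rightarrow> (real ^ 'd) set set). 0 < \<delta> \<longrightarrow>
      (\<forall>j\<in>J. finite (\<T> j)) \<longrightarrow>
      (\<forall>j\<in>J. \<forall>T\<in>\<T> j. \<exists>\<omega>. norm (\<omega> - axis j 1) \<le> ?\<kappa> \<and> tube_with_direction \<delta> \<omega> T) \<longrightarrow>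
      (\<integral>\<^sup>+ x. ennreal ((\<Prod>j\<in>J. \<Sum>T\<in>\<T> j. indicator T x) powr p) \<partial>lborel)
        \<le> ennreal (C * \<delta> ^ CARD('d) * (\<Prod>j\<in>J. real (card (\<T> j)) powr p))"
      using multilinear_kakeya_powr[OF J2 pJ] by (elim exE conjE)
    show ?thesis
    proof (intro exI[of _ "C powr (1 / p)"] allI impI)
      fix \<delta> :: real and \<T> :: "nat \<Rightarrow> (real ^ 'd) set set"
      assume H: "0 < \<delta> \<and> \<delta> \<le> 1 \<and>
        (\<forall>j\<in>{1..n}. finite (\<T> j) \<and> (\<forall>T\<in>\<T> j. \<exists>\<omega>\<in>N j. tube_with_direction \<delta> \<omega> T))"
      then have \<delta>: "0 < \<delta>" by blast
      define K where "K = C powr (1 / p) * (\<Prod>j=1..n. \<delta> powr (?d / r) * real (card (\<T> j)))"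
      have K: "0 \<le> K" by (auto simp: K_def intro!: mult_nonneg_nonneg prod_nonneg)
      have \<delta>pow: "((\<delta> powr (?d / r)) ^ n) powr p = \<delta> ^ CARD('d)"
        using \<delta> r0 n by (simp add: powr_realpow[symmetric] powr_powr p_def)
      have Kp: "K powr p = C * \<delta> ^ CARD('d) * (\<Prod>j=1..n. real (card (\<T> j)) powr p)"
        using C p0 \<delta>pow
        by (simp add: K_def prod.distrib powr_mult prod_nonneg powr_powr prod_powr_distrib)
      have "(\<integral>\<^sup>+ x. ennreal ((\<Prod>j\<in>J. \<Sum>T\<in>\<T> (inv_into {1..n} b j). indicator T x) powr p) \<partial>lborel)
          \<le> ennreal (C * \<delta> ^ CARD('d) * (\<Prod>j\<in>J. real (card (\<T> (inv_into {1..n} b j))) powr p))"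
      proof (rule est[THEN spec, THEN spec, THEN mp, OF \<delta>, THEN mp, THEN mp])
        have inv: "inv_into {1..n} b k \<in> {1..n}" "b (inv_into {1..n} b k) = k" if "k \<in> J" for k
          using that inv_into_into[of k b "{1..n}"] f_inv_into_f[of k b "{1..n}"] by (simp_all only: J_def)
        show "\<forall>j\<in>J. finite (\<T> (inv_into {1..n} b j))" using H inv by blast
        show "\<forall>k\<in>J. \<forall>T\<in>\<T> (inv_into {1..n} b k). \<exists>\<omega>. norm (\<omega> - axis k 1) \<le> ?\<kappa> \<and> tube_with_direction \<delta> \<omega> T"
        proof (intro ballI)
          fix k T assume k: "k \<in> J" and T: "T \<in> \<T> (inv_into {1..n} b k)"
          obtain \<omega> where "\<omega> \<in> N (inv_into {1..n} b k)" "tube_with_direction \<delta> \<omega> T"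
            using H inv(1)[OF k] T by blast
          then show "\<exists>\<omega>. norm (\<omega> - axis k 1) \<le> ?\<kappa> \<and> tube_with_direction \<delta> \<omega> T"
            unfolding N_def inv(2)[OF k] by (intro exI[of _ \<omega>]) (simp add: dist_norm norm_minus_commute)
        qed
      qed
      then have int: "(\<integral>\<^sup>+ x. ennreal ((\<Prod>j=1..n. \<Sum>T\<in>\<T> j. indicator T x) powr p) \<partial>lborel) \<le> ennreal (K powr p)"
        unfolding Kp reindex[of "\<lambda>j. \<Sum>T\<in>\<T> j. indicator T _"] reindex[of "\<lambda>j. real (card (\<T> j)) powr p"] .
      have "Lnorm lborel (ereal p) (\<lambda>x. \<Prod>j=1..n. \<Sum>T\<in>\<T> j. indicator T x) \<le> ennreal K"
        by (rule Lnorm_le[OF p0 _ K int]) (auto intro!: prod_nonneg sum_nonneg)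
      then show "Lnorm lborel (q / ereal (real n)) (\<lambda>x. \<Prod>j=1..n. \<Sum>T\<in>\<T> j. indicator T x)
          \<le> ennreal (C powr (1 / p) * (\<Prod>j=1..n. \<delta> powr real_of_ereal (ereal ?d / q) * real (card (\<T> j))))"
        using real n r0 by (simp add: K_def p_def)
    qed
  qed
  show ?thesis
    using open_N main by (intro exI[of _ N]) blast
qed

end
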